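(* Fix an integer $d \geq 3$ and a real number $\lambda < d$. For infinitely many positive integers $n$ (with $n\to\infty$), let $G=G_n$ be an $(n,d,\lambda)$ graph whose girth is at least $g=g(n)$, where $g(n)\to\infty$ as $n\to\infty$. Let $w_0 \in V(G)$, let $\widetilde{W}=(w_0,w_1,\ldots,w_n)$ be a non-backtracking random walk of length $n$ on $G$ starting from $w_0$, and for each integer $t\ge 0$ let $$N_t = \Big|\big\{ v \in V(G) : |\{1\leq i\leq n : w_i=v\}|=t \big\}\Big|$$ be the number of vertices which $\widetilde{W}$ visits precisely $t$ times. Then for every fixed integer $t \geq 0$, $$\frac{N_t}{n} = \frac{1}{\mathrm{e}\,t!} + o(1) \quad\text{with high probability},$$ where the $o(1)$-term tends to $0$ as $n\to\infty$; that is, there is a deterministic sequence $\epsilon_n\to 0$ such that $\Pr\big[\,|N_t/n - 1/(\mathrm{e}\,t!)| \le \epsilon_n\big] \to 1$ as $n\to\infty$.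
   Context: An $(n,d,\lambda)$ graph is a $d$-regular undirected graph on $n$ vertices such that, if $d=\lambda_1\ge\lambda_2\ge\dots\ge\lambda_n$ are the eigenvalues of its adjacency matrix, then $\max_{i>1}|\lambda_i| = \lambda$. The girth is the length of a shortest cycle. A non-backtracking random walk of length $k$ on $G$ starting from a vertex $w_0$ is a random sequence $(w_0,\ldots,w_k)$ of vertices, where $w_1$ is a uniformly chosen neighbor of $w_0$ and, for $i\ge 2$, given $w_0,\ldots,w_{i-1}$, the vertex $w_i$ is chosen uniformly among all neighbors of $w_{i-1}$ other than $w_{i-2}$. An event, defined for every $n$, occurs with high probability (the paper also says "almost surely") if its probability tends to $1$ as $n\to\infty$. *)

theory Defs
  imports
    "Graph_Theory.Pair_Digraph"
    "Jordan_Normal_Form.Char_Poly"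
    "HOL-Probability.Probability_Mass_Function"
begin

text \<open>
  An undirected graph is a \<^locale>\<open>pair_graph\<close>: a finite, loop-free, symmetric relation,
  each edge \<open>{u, v}\<close> being represented by the two arcs \<open>(u, v)\<close> and \<open>(v, u)\<close>.
\<close>

definition adjacency_mat :: "'a pair_pre_digraph \<Rightarrow> 'a list \<Rightarrow> real mat" where
  "adjacency_mat G vs =
     Matrix.mat (length vs) (length vs) (\<lambda>(i, j). if (vs ! i, vs ! j) \<in> parcs G then 1 else 0)"

text \<open>The eigenvalues listed with (algebraic) multiplicity, in decreasing order.\<close>

definition ordered_eigenvalues :: "real mat \<Rightarrow> real list \<Rightarrow> bool" where
  "ordered_eigenvalues A ls \<longleftrightarrow>
     length ls = dim_row A \<and> sorted_wrt (\<ge>) ls \<and> char_poly A = (\<Prod>l\<leftarrow>ls. [:- l, 1:])"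

text \<open>
  Different enumerations \<open>vs\<close> of the vertices give permutation-similar adjacency matrices, hence
  the same \<open>ls\<close>. Lists are indexed from 0, so \<open>ls ! 0\<close> is \<open>\<lambda>\<^sub>1\<close> and the maximum over \<open>i > 1\<close>
  ranges over the list positions \<open>{1..<n}\<close>.
\<close>

definition ndl_graph :: "nat \<Rightarrow> nat \<Rightarrow> real \<Rightarrow> 'a pair_pre_digraph \<Rightarrow> bool" where
  "ndl_graph n d lam G \<longleftrightarrow>
     pair_graph G \<and> card (pverts G) = n \<and>
     (\<forall>v\<in>pverts G. out_degree (with_proj G) v = d) \<and>
     (\<exists>vs ls. distinct vs \<and> set vs = pverts G \<and>
        ordered_eigenvalues (adjacency_mat G vs) ls \<and>
        ls ! 0 = real d \<and> Max ((\<lambda>i. \<bar>ls ! i\<bar>) ` {1..<n}) = lam)"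

text \<open>
  The library's directed notion of cycle also counts the closed walk \<open>u, v, u\<close> along a single edge;
  requiring length at least 3 leaves exactly the cycles of the undirected graph. The girth is
  \<open>\<infinity>\<close> if there is no cycle.
\<close>

definition girth :: "'a pair_pre_digraph \<Rightarrow> enat" where
  "girth G = (INF p\<in>{p. pre_digraph.cycle (with_proj G) p \<and> 3 \<le> length p}. enat (length p))"

text \<open>
  The law of the vertex sequence \<open>[w\<^sub>0, \<dots>, w\<^sub>k]\<close>. In the step to \<open>w\<^sub>k\<^sub>+\<^sub>1\<close> the constraint
  \<open>v \<noteq> w\<^sub>k\<^sub>-\<^sub>1\<close> is absent for \<open>k = 0\<close>. \<^const>\<open>pmf_of_set\<close> is only meaningful for a finite nonempty
  set, that is, if all degrees are finite and at least 2.
\<close>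

primrec nb_walk :: "'a pair_pre_digraph \<Rightarrow> 'a \<Rightarrow> nat \<Rightarrow> 'a list pmf" where
  "nb_walk G u 0 = return_pmf [u]"
| "nb_walk G u (Suc k) =
     bind_pmf (nb_walk G u k) (\<lambda>ws.
       map_pmf (\<lambda>v. ws @ [v])
         (pmf_of_set {v. (ws ! k, v) \<in> parcs G \<and> (k \<ge> 1 \<longrightarrow> v \<noteq> ws ! (k - 1))}))"

text \<open>The starting position \<open>w\<^sub>0\<close> does not count as a visit.\<close>

definition num_visited :: "'a pair_pre_digraph \<Rightarrow> nat \<Rightarrow> nat \<Rightarrow> 'a list \<Rightarrow> nat" where
  "num_visited G n t ws = card {v \<in> pverts G. card {i \<in> {1..n}. ws ! i = v} = t}"

end

theory Submission
  imports Defs "Jordan_Normal_Form.Schur_Decomposition" "HOL-Real_Asymp.Real_Asymp"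
begin

text \<open>
  Let \<open>y\<^sub>t(s)\<close> be the proportion of vertices visited exactly \<open>t\<close> times in the first \<open>s\<close> steps and
  \<open>b\<^sub>t(s)\<close> the probability that a binomial variable with parameters \<open>s\<close> and \<open>1/n\<close> equals \<open>t\<close>. The
  spectral gap makes the non-backtracking walk mix at an exponential rate that does not depend on
  \<open>n\<close>. Hence the next vertex is almost uniform given the walk up to \<open>L = \<lfloor>\<surd>n\<rfloor>\<close> steps ago, and by the
  girth condition it is unlikely to be one of the last \<open>L\<close> vertices. So the increment of \<open>y\<^sub>t\<close> has
  conditional mean \<open>(y\<^sub>t\<^sub>-\<^sub>1 - y\<^sub>t)/n + o(1/n)\<close>, while \<open>b\<^sub>t\<close> satisfies the same recurrence exactly. For
  \<open>D\<^sub>t = y\<^sub>t - b\<^sub>t\<close> this gives \<open>E D\<^sub>t(s + 1)\<^sup>2 \<le> E D\<^sub>t(s)\<^sup>2 + (E D\<^sub>t\<^sub>-\<^sub>1(s - L)\<^sup>2 + o(1))/n\<close>; thus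
  \<open>E D\<^sub>t(n)\<^sup>2\<close> tends to 0 by induction on \<open>t\<close>, and Chebyshev's inequality together with
  \<open>b\<^sub>t(n) \<longlonglongrightarrow> 1/(e t!)\<close> finishes the proof.
\<close>

section \<open>Traces of matrix powers\<close>

lemma upper_triangular_mult:
  fixes A B :: "'a::semiring_0 mat"
  assumes A: "A \<in> carrier_mat n n" "upper_triangular A"
    and B: "B \<in> carrier_mat n n" "upper_triangular B"
  shows "upper_triangular (A * B)"
    and "i < n \<Longrightarrow> (A * B) $$ (i, i) = A $$ (i, i) * B $$ (i, i)"
proof -
  have entry: "(A * B) $$ (i, j) = (\<Sum>k = 0..<n. A $$ (i, k) * B $$ (k, j))" if "i < n" "j < n" for i j
    using that A B by (auto simp: scalar_prod_def intro!: sum.cong)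
  show "upper_triangular (A * B)"
  proof (rule upper_triangularI)
    fix i j assume ij: "j < i" "i < dim_row (A * B)"
    then have "i < n" "j < n" using A by auto
    moreover have "A $$ (i, k) * B $$ (k, j) = 0" if "k < n" for k
    proof (cases "k < i")
      case True then show ?thesis using A ij by (simp add: upper_triangularD)
    next
      case False then show ?thesis using B ij that by (simp add: upper_triangularD)
    qed
    ultimately show "(A * B) $$ (i, j) = 0" by (simp add: entry)
  qed
  show "(A * B) $$ (i, i) = A $$ (i, i) * B $$ (i, i)" if "i < n"
  proof -
    have "A $$ (i, k) * B $$ (k, i) = 0" if "k < n" "k \<noteq> i" for k
    proof (cases "k < i")
      case True then show ?thesis using A \<open>i < n\<close> by (simp add: upper_triangularD)
    next
      case False then show ?thesis using B that by (simp add: upper_triangularD)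
    qed
    then have "(\<Sum>k = 0..<n. A $$ (i, k) * B $$ (k, i)) = (\<Sum>k\<in>{i}. A $$ (i, k) * B $$ (k, i))"
      using that by (intro sum.mono_neutral_right) auto
    then show ?thesis using that by (simp add: entry)
  qed
qed

lemma upper_triangular_pow:
  fixes A :: "'a::semiring_1 mat"
  assumes "A \<in> carrier_mat n n" "upper_triangular A"
  shows "upper_triangular (A ^\<^sub>m k) \<and> (\<forall>i<n. (A ^\<^sub>m k) $$ (i, i) = A $$ (i, i) ^ k)"
proof (induction k)
  case 0
  then show ?case using assms by auto
next
  case (Suc k)
  then show ?case
    using upper_triangular_mult[of "A ^\<^sub>m k" n A] assms by (auto simp: power_commutes)
qed

definition mat_trace :: "'a::comm_monoid_add mat \<Rightarrow> 'a" where
  "mat_trace A = (\<Sum>i = 0..<dim_row A. A $$ (i, i))"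

lemma mat_trace_comm:
  fixes A B :: "'a::comm_semiring_0 mat"
  assumes "A \<in> carrier_mat n m" "B \<in> carrier_mat m n"
  shows "mat_trace (A * B) = mat_trace (B * A)"
proof -
  have "mat_trace (A * B) = (\<Sum>i = 0..<n. \<Sum>k = 0..<m. A $$ (i, k) * B $$ (k, i))"
    using assms by (auto simp: mat_trace_def scalar_prod_def intro!: sum.cong)
  also have "\<dots> = (\<Sum>k = 0..<m. \<Sum>i = 0..<n. B $$ (k, i) * A $$ (i, k))"
    by (subst sum.swap) (simp add: mult.commute)
  also have "\<dots> = mat_trace (B * A)"
    using assms by (auto simp: mat_trace_def scalar_prod_def intro!: sum.cong)
  finally show ?thesis .
qed

text \<open>Schur triangularisation writes \<open>A\<close> as \<open>P * B * Q\<close> with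
  \<open>Q\<close> inverse to \<open>P\<close> and the list \<open>ls\<close> on the diagonal of
  \<open>B\<close>. Powers of \<open>B\<close> stay triangular with powered diagonal, and cyclicity
  of the trace cancels \<open>P\<close> against \<open>Q\<close>.\<close>

lemma mat_trace_pow_eq_sum_eigenvalues:
  fixes A :: "'a::conjugatable_ordered_field mat"
  assumes A: "A \<in> carrier_mat n n" and cp: "char_poly A = (\<Prod>l\<leftarrow>ls. [:- l, 1:])"
  shows "length ls = n" and "mat_trace (A ^\<^sub>m k) = (\<Sum>i = 0..<n. (ls ! i) ^ k)"
proof -
  obtain B P Q where S: "schur_decomposition A ls = (B, P, Q)"
    by (cases "schur_decomposition A ls") auto
  note schur = schur_decomposition[OF A cp S]
  then have sim: "similar_mat_wit A B P Q" and diag: "diag_mat B = ls" and upper: "upper_triangular B"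
    by auto
  note wit = similar_mat_witD2[OF A sim]
  then have B: "B \<in> carrier_mat n n" and P: "P \<in> carrier_mat n n" and Q: "Q \<in> carrier_mat n n"
    and QP: "Q * P = 1\<^sub>m n" by blast+
  show "length ls = n" using diag B by (auto simp: diag_mat_def)
  have Bk: "B ^\<^sub>m k \<in> carrier_mat n n" using B by simp
  have "mat_trace (A ^\<^sub>m k) = mat_trace ((P * B ^\<^sub>m k) * Q)"
    using similar_mat_wit_pow_id[OF sim] by simp
  also have "\<dots> = mat_trace (Q * (P * B ^\<^sub>m k))"
    using P Q Bk by (intro mat_trace_comm[of _ n n]) auto
  also have "Q * (P * B ^\<^sub>m k) = B ^\<^sub>m k"
    using P Q Bk QP by (subst assoc_mult_mat[symmetric, of _ n n _ n _ n]) auto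
  also have "mat_trace \<dots> = (\<Sum>i = 0..<n. (ls ! i) ^ k)"
    using upper_triangular_pow[OF B upper, of k] B diag
    by (auto simp: mat_trace_def diag_mat_def intro!: sum.cong)
  finally show "mat_trace (A ^\<^sub>m k) = (\<Sum>i = 0..<n. (ls ! i) ^ k)" .
qed

text \<open>Log-convexity makes the ratios \<open>c (Suc k) / c k\<close> nondecreasing, so a lower
  bound on the first ratio persists. Read backwards, an upper bound on the long-term growth controls
  the first ratio.\<close>

lemma log_convex_ge_power:
  fixes c :: "nat \<Rightarrow> real"
  assumes pos: "c 0 > 0"
    and convex: "\<And>k. (c (Suc k))\<^sup>2 \<le> c k * c (Suc (Suc k))"
    and r: "r > 0" "c 1 \<ge> r * c 0"
  shows "c k \<ge> r ^ k * c 0"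
proof -
  \<comment> \<open>Positivity travels with the ratio bound through the induction, since each step
    cancels a factor \<open>c k\<close>.\<close>
  have "c k > 0 \<and> c (Suc k) \<ge> r * c k" for k
  proof (induction k)
    case 0
    then show ?case using pos r by simp
  next
    case (Suc k)
    then have p: "c (Suc k) > 0" by (smt (verit) r mult_pos_pos)
    have "c k * (r * c (Suc k)) \<le> c (Suc k) * c (Suc k)"
      using Suc p by (simp add: mult.commute mult.left_commute)
    also have "\<dots> \<le> c k * c (Suc (Suc k))"
      using convex[of k] by (simp add: power2_eq_square)
    finally show ?case using p Suc by simp
  qed
  then have step: "c (Suc k) \<ge> r * c k" for k by blast
  show ?thesis
  proof (induction k)
    case (Suc k)
    then have "r * (r ^ k * c 0) \<le> r * c k" using r by simp
    then show ?case using step[of k] by (simp add: mult.assoc)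
  qed simp
qed

lemma pow_mat_add:
  fixes A :: "'a::semiring_1 mat"
  assumes "A \<in> carrier_mat n n"
  shows "A ^\<^sub>m (j + k) = A ^\<^sub>m j * A ^\<^sub>m k"
proof (induction k)
  case (Suc k)
  then show ?case using assms by (simp add: assoc_mult_mat[of _ n n _ n _ n])
qed (use assms in auto)

lemma symmetric_mat_pow:
  fixes A :: "'a::comm_semiring_1 mat"
  assumes "A \<in> carrier_mat n n" "A\<^sup>T = A"
  shows "(A ^\<^sub>m k)\<^sup>T = A ^\<^sub>m k"
proof (induction k)
  case (Suc k)
  have "A * A ^\<^sub>m k = A ^\<^sub>m k * A"
    using pow_mat_add[OF assms(1), of 1 k] assms(1) by simp
  with Suc show ?case using assms
    by (simp add: transpose_mult[of _ n n _ n])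
qed (use assms in auto)

lemma row_sum_pow:
  fixes A :: "real mat"
  assumes A: "A \<in> carrier_mat n n" and row: "\<And>i. i < n \<Longrightarrow> (\<Sum>j = 0..<n. A $$ (i, j)) = d"
    and "i < n"
  shows "(\<Sum>j = 0..<n. (A ^\<^sub>m k) $$ (i, j)) = d ^ k"
  using \<open>i < n\<close>
proof (induction k arbitrary: i)
  case 0
  then show ?case using A by (simp add: one_mat_def)
next
  case (Suc k)
  have "(\<Sum>j = 0..<n. (A ^\<^sub>m Suc k) $$ (i, j)) = (\<Sum>j = 0..<n. \<Sum>l = 0..<n. (A ^\<^sub>m k) $$ (i, l) * A $$ (l, j))"
    using A Suc.prems by (auto simp: scalar_prod_def intro!: sum.cong)
  also have "\<dots> = (\<Sum>l = 0..<n. (A ^\<^sub>m k) $$ (i, l) * (\<Sum>j = 0..<n. A $$ (l, j)))"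
    by (subst sum.swap) (simp add: sum_distrib_left)
  also have "\<dots> = (\<Sum>l = 0..<n. (A ^\<^sub>m k) $$ (i, l)) * d"
    by (simp add: row sum_distrib_right)
  finally show ?case using Suc by simp
qed

text \<open>The left side is the squared Frobenius norm of the \<open>k\<close>-th power after its
  action on constant vectors has been removed. Row sums \<open>d ^ k\<close> make the cross term
  collapse, so exactly the contribution of one eigenvalue \<open>d\<close> leaves the trace.\<close>

lemma sum_centered_pow_entries_square:
  fixes A :: "real mat"
  assumes A: "A \<in> carrier_mat n n" "A\<^sup>T = A" and "n > 0"
    and row: "\<And>i. i < n \<Longrightarrow> (\<Sum>j = 0..<n. A $$ (i, j)) = d"
  shows "(\<Sum>i = 0..<n. \<Sum>j = 0..<n. ((A ^\<^sub>m k) $$ (i, j) - d ^ k / n)\<^sup>2)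
    = mat_trace (A ^\<^sub>m (2 * k)) - d ^ (2 * k)"
proof -
  define B where "B = A ^\<^sub>m k"
  have B: "B \<in> carrier_mat n n" "B\<^sup>T = B"
    using A symmetric_mat_pow[OF A] by (auto simp: B_def)
  then have sym: "B $$ (i, j) = B $$ (j, i)" if "i < n" "j < n" for i j
    using that by (metis carrier_matD index_transpose_mat(1))
  have "A ^\<^sub>m (2 * k) = B * B"
    using pow_mat_add[OF A(1), of k k] by (simp add: B_def mult_2)
  then have tr: "mat_trace (A ^\<^sub>m (2 * k)) = (\<Sum>i = 0..<n. \<Sum>j = 0..<n. (B $$ (i, j))\<^sup>2)"
    using B(1) sym by (auto simp: mat_trace_def scalar_prod_def power2_eq_square intro!: sum.cong)
  have row: "(\<Sum>j = 0..<n. B $$ (i, j)) = d ^ k" if "i < n" for i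
    unfolding B_def using A row that by (intro row_sum_pow) auto
  have "(\<Sum>j = 0..<n. (B $$ (i, j) - d ^ k / n)\<^sup>2)
      = (\<Sum>j = 0..<n. (B $$ (i, j))\<^sup>2) - d ^ (2 * k) / n" if "i < n" for i
  proof -
    have "(\<Sum>j = 0..<n. (B $$ (i, j) - d ^ k / n)\<^sup>2)
      = (\<Sum>j = 0..<n. (B $$ (i, j))\<^sup>2) - 2 * (d ^ k / n) * (\<Sum>j = 0..<n. B $$ (i, j)) + n * (d ^ k / n)\<^sup>2"
      by (simp add: power2_diff sum.distrib sum_subtractf sum_distrib_left sum_divide_distrib mult_ac)
    also have "\<dots> = (\<Sum>j = 0..<n. (B $$ (i, j))\<^sup>2) - d ^ (2 * k) / n"
      using \<open>n > 0\<close> row[OF that] by (simp add: field_simps power2_eq_square power_mult)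
    finally show ?thesis .
  qed
  then show ?thesis
    using tr \<open>n > 0\<close> by (simp add: B_def sum_subtractf)
qed

section \<open>Mixing of the non-backtracking walk\<close>

definition nbrs :: "'a pair_pre_digraph \<Rightarrow> 'a \<Rightarrow> 'a set" where
  "nbrs G v = {w. (v, w) \<in> parcs G}"

locale regular_graph = pair_graph G for G :: "'a pair_pre_digraph" +
  fixes d :: nat
  assumes verts_nonempty: "pverts G \<noteq> {}"
    and card_nbrs: "v \<in> pverts G \<Longrightarrow> card (nbrs G v) = d"
    and d_ge: "d \<ge> 3"
begin

abbreviation V where "V \<equiv> pverts G"
abbreviation N where "N \<equiv> nbrs G"

definition q :: real where "q = real d - 1"

definition Adj :: "('a \<Rightarrow> real) \<Rightarrow> 'a \<Rightarrow> real" where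
  "Adj f v = (\<Sum>w\<in>N v. f w)"

definition ip :: "('a \<Rightarrow> real) \<Rightarrow> ('a \<Rightarrow> real) \<Rightarrow> real" where
  "ip f g = (\<Sum>v\<in>V. f v * g v)"

text \<open>Acts on functions of the last arc traversed, as two consecutive vertices.\<close>

definition nbop :: "('a \<Rightarrow> 'a \<Rightarrow> real) \<Rightarrow> 'a \<Rightarrow> 'a \<Rightarrow> real" where
  "nbop \<phi> x y = (\<Sum>z\<in>N y - {x}. \<phi> y z) / q"

text \<open>A bound on the operator norm of the adjacency operator on the orthogonal complement of
  the constants, written with quadratic forms so that no eigenvectors enter.\<close>

definition spectral_gap :: "real \<Rightarrow> bool" where
  "spectral_gap \<Lambda> \<longleftrightarrow> (\<forall>f. (\<Sum>v\<in>V. f v) = 0 \<longrightarrow> ip (Adj f) (Adj f) \<le> \<Lambda>\<^sup>2 * ip f f)"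

lemma q_ge: "q \<ge> 2"
  using d_ge by (simp add: q_def)

lemma nbrs_sym: "w \<in> N v \<longleftrightarrow> v \<in> N w"
  using pair_sym_arcs by (auto simp: nbrs_def symmetric_def elim: symE)

lemma nbrs_irrefl: "v \<notin> N v"
  using pair_no_loops by (force simp: nbrs_def)

lemma nbrs_subset: "N v \<subseteq> V"
  using arc_snd_in_verts by (force simp: nbrs_def)

lemma finite_nbrs [simp]: "finite (N v)"
  by (rule finite_subset[OF nbrs_subset pair_finite_verts])

section \<open>Self-adjointness and decay for the adjacency operator\<close>

lemma sum_Adj_mult: "(\<Sum>v\<in>V. Adj f v * g v) = (\<Sum>v\<in>V. f v * Adj g v)"
proof -
  have N_eq: "N v = {w. w \<in> V \<and> v \<in> N w}" for v
    using nbrs_subset nbrs_sym by blast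
  have "(\<Sum>v\<in>V. Adj f v * g v) = (\<Sum>v\<in>V. \<Sum>w | w \<in> V \<and> w \<in> N v. f w * g v)"
    using nbrs_subset by (intro sum.cong refl) (auto simp: Adj_def sum_distrib_right intro!: sum.cong)
  also have "\<dots> = (\<Sum>w\<in>V. \<Sum>v | v \<in> V \<and> w \<in> N v. f w * g v)"
    by (rule sum.swap_restrict) (auto simp: pair_finite_verts)
  also have "\<dots> = (\<Sum>w\<in>V. f w * Adj g w)"
    unfolding Adj_def sum_distrib_left N_eq[symmetric] ..
  finally show ?thesis .
qed

lemma ip_Adj: "ip (Adj f) g = ip f (Adj g)"
  by (simp add: ip_def sum_Adj_mult)

lemma ip_self_nonneg [simp]: "ip f f \<ge> 0"
  by (simp add: ip_def sum_nonneg)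

lemma ip_scale: "ip (\<lambda>v. c * f v) (\<lambda>v. c * f v) = c\<^sup>2 * ip f f"
  by (simp add: ip_def sum_distrib_left power2_eq_square mult_ac)

lemma abs_le_sqrt_ip:
  assumes "v \<in> V"
  shows "\<bar>f v\<bar> \<le> sqrt (ip f f)"
proof -
  have "(f v)\<^sup>2 \<le> ip f f"
    unfolding ip_def power2_eq_square
    by (rule member_le_sum[OF assms]) (auto simp: pair_finite_verts)
  then show ?thesis by (metis real_sqrt_abs real_sqrt_le_mono)
qed

lemma sum_Adj:
  fixes f :: "'a \<Rightarrow> real"
  shows "(\<Sum>v\<in>V. Adj f v) = d * (\<Sum>v\<in>V. f v)"
proof -
  have "Adj (\<lambda>_. 1) v = d" if "v \<in> V" for v
    using card_nbrs[OF that] by (simp add: Adj_def)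
  then show ?thesis
    using sum_Adj_mult[of f "\<lambda>_. 1"] by (simp add: sum_distrib_left mult.commute)
qed

text \<open>Weighted AM-GM, \<open>2 s t\<close> at most
  \<open>s\<^sup>2 / \<Lambda> + \<Lambda> t\<^sup>2\<close>. This weight is the one for which the
  gap turns both coefficients into \<open>\<Lambda>\<close>.\<close>

lemma two_ip_Adj_le:
  assumes gap: "spectral_gap \<Lambda>" "\<Lambda> > 0" and mean: "(\<Sum>v\<in>V. f v) = 0"
  shows "\<bar>2 * ip (Adj f) g\<bar> \<le> \<Lambda> * (ip f f + ip g g)"
proof -
  have pt: "\<bar>2 * (s * t)\<bar> \<le> s\<^sup>2 / \<Lambda> + \<Lambda> * t\<^sup>2" for s t :: real
  proof -
    have "0 \<le> (s - \<Lambda> * t)\<^sup>2 / \<Lambda>" "0 \<le> (s + \<Lambda> * t)\<^sup>2 / \<Lambda>" using gap by auto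
    moreover have "(s - \<Lambda> * t)\<^sup>2 / \<Lambda> = s\<^sup>2 / \<Lambda> + \<Lambda> * t\<^sup>2 - 2 * (s * t)"
      "(s + \<Lambda> * t)\<^sup>2 / \<Lambda> = s\<^sup>2 / \<Lambda> + \<Lambda> * t\<^sup>2 + 2 * (s * t)"
      using gap by (simp_all add: field_simps power2_eq_square)
    ultimately show ?thesis by linarith
  qed
  have "\<bar>2 * ip (Adj f) g\<bar> \<le> (\<Sum>v\<in>V. \<bar>2 * (Adj f v * g v)\<bar>)"
    unfolding ip_def sum_distrib_left by (rule sum_abs)
  also have "\<dots> \<le> (\<Sum>v\<in>V. (Adj f v)\<^sup>2 / \<Lambda> + \<Lambda> * (g v)\<^sup>2)"
    by (rule sum_mono) (rule pt)
  also have "\<dots> = ip (Adj f) (Adj f) / \<Lambda> + \<Lambda> * ip g g"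
    by (simp add: ip_def sum.distrib sum_distrib_left sum_divide_distrib power2_eq_square)
  also have "\<dots> \<le> \<Lambda>\<^sup>2 * ip f f / \<Lambda> + \<Lambda> * ip g g"
    using gap mean by (intro add_right_mono divide_right_mono) (auto simp: spectral_gap_def)
  also have "\<dots> = \<Lambda> * (ip f f + ip g g)"
    using gap by (simp add: field_simps power2_eq_square)
  finally show ?thesis .
qed

text \<open>
  The quadratic form \<open>(1 + b) (\<bar>x\<bar>\<^sup>2 + \<bar>y\<bar>\<^sup>2) - 2 \<langle>a A x, y\<rangle>\<close> is a Lyapunov function of the recurrence: it
  decreases by \<open>(1 - b) \<bar>a A x - (1 + b) y\<bar>\<^sup>2\<close> in each step. It makes a diagonalisation of the adjacency
  operator unnecessary.
\<close>

lemma two_term_recurrence_bounded: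
  fixes y :: "nat \<Rightarrow> 'a \<Rightarrow> real"
  assumes gap: "spectral_gap \<Lambda>" "\<Lambda> > 0"
    and rec: "\<And>m v. v \<in> V \<Longrightarrow> y (Suc (Suc m)) v = a * Adj (y (Suc m)) v - b * y m v"
    and mean: "\<And>m. (\<Sum>v\<in>V. y m v) = 0"
    and ab: "a > 0" "b \<le> 1" "a * \<Lambda> < 1 + b"
  shows "(1 + b - a * \<Lambda>) * ip (y m) (y m) \<le> 2 * (1 + b) * (ip (y 0) (y 0) + ip (y 1) (y 1))"
proof -
  define L where "L m = (1 + b) * (ip (y (Suc m)) (y (Suc m)) + ip (y m) (y m))
    - 2 * a * ip (Adj (y (Suc m))) (y m)" for m
  define S where "S m = ip (y (Suc m)) (y (Suc m)) + ip (y m) (y m)" for m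
  have "L m - L (Suc m) = (1 - b) * (\<Sum>v\<in>V. (a * Adj (y (Suc m)) v - (1 + b) * y m v)\<^sup>2)" for m
  proof -
    have L1: "L (Suc m) = (1 + b) * (\<Sum>v\<in>V. (a * Adj (y (Suc m)) v - b * y m v)\<^sup>2 + (y (Suc m) v)\<^sup>2)
      - 2 * a * (\<Sum>v\<in>V. (a * Adj (y (Suc m)) v - b * y m v) * Adj (y (Suc m)) v)"
      unfolding L_def ip_Adj by (simp add: ip_def rec sum.distrib power2_eq_square)
    have L0: "L m = (1 + b) * (\<Sum>v\<in>V. (y (Suc m) v)\<^sup>2 + (y m v)\<^sup>2)
      - 2 * a * (\<Sum>v\<in>V. Adj (y (Suc m)) v * y m v)"
      unfolding L_def by (simp add: ip_def sum.distrib power2_eq_square)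
    show ?thesis
      unfolding L0 L1 sum_distrib_left sum_subtractf[symmetric]
      by (intro sum.cong refl) (simp add: algebra_simps power2_eq_square)
  qed
  moreover have "0 \<le> (1 - b) * (\<Sum>v\<in>V. (a * Adj (y (Suc m)) v - (1 + b) * y m v)\<^sup>2)" for m
    using ab by (intro mult_nonneg_nonneg sum_nonneg) auto
  ultimately have "L (Suc m) \<le> L m" for m by (smt (verit))
  then have decr: "L m \<le> L 0" for m
    by (induction m) (auto intro: order_trans)
  \<comment> \<open>Hence \<open>L\<close> lies between \<open>(1 + b - a * \<Lambda>) * S\<close>
    and \<open>(1 + b + a * \<Lambda>) * S\<close>. The lower factor is positive by assumption, so
    the decreasing quantity \<open>L\<close> controls the norms.\<close>
  have cross: "\<bar>2 * a * ip (Adj (y (Suc m))) (y m)\<bar> \<le> a * \<Lambda> * S m" for m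
  proof -
    have "a * \<bar>2 * ip (Adj (y (Suc m))) (y m)\<bar> \<le> a * (\<Lambda> * S m)"
      using two_ip_Adj_le[OF gap mean, of "Suc m" "y m"] ab by (simp add: S_def)
    then show ?thesis using ab by (simp add: abs_mult mult_ac)
  qed
  have "(1 + b - a * \<Lambda>) * ip (y m) (y m) \<le> (1 + b - a * \<Lambda>) * S m"
    using ab by (intro mult_left_mono) (auto simp: S_def)
  also have "\<dots> \<le> L m"
    using cross[of m] by (simp add: L_def S_def algebra_simps)
  also note decr
  also have "L 0 \<le> (1 + b + a * \<Lambda>) * S 0"
    using cross[of 0] by (simp add: L_def S_def algebra_simps)
  also have "\<dots> \<le> 2 * (1 + b) * S 0"
    using ab by (intro mult_right_mono) (auto simp: S_def)
  finally show ?thesis by (simp add: S_def add.commute)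
qed

text \<open>Rescaling by \<open>\<theta> ^ m\<close> reduces decay to boundedness. With
  \<open>a = 1 / (q \<theta>)\<close> and \<open>b = 1 / (q \<theta>\<^sup>2)\<close>, the condition
  \<open>\<Lambda> < q * \<theta> + 1 / \<theta>\<close> is precisely
  \<open>a * \<Lambda> < 1 + b\<close>, while \<open>\<theta> \<ge> 3 / 4\<close> and
  \<open>q \<ge> 2\<close> give \<open>b \<le> 1\<close>. The constant 8 is 4 from
  \<open>2 * (1 + b)\<close> times 2 from \<open>1 / \<theta>\<^sup>2\<close>.\<close>

lemma two_term_recurrence_decay:
  fixes x :: "nat \<Rightarrow> 'a \<Rightarrow> real"
  assumes gap: "spectral_gap \<Lambda>" "\<Lambda> > 0"
    and rec: "\<And>m v. v \<in> V \<Longrightarrow> q * x (Suc (Suc m)) v = Adj (x (Suc m)) v - x m v"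
    and mean: "\<And>m. (\<Sum>v\<in>V. x m v) = 0"
    and \<theta>: "3 / 4 \<le> \<theta>" "\<theta> < 1" "\<Lambda> < q * \<theta> + 1 / \<theta>"
  shows "(1 + 1 / (q * \<theta>\<^sup>2) - \<Lambda> / (q * \<theta>)) * ip (x m) (x m)
    \<le> 8 * (ip (x 0) (x 0) + ip (x 1) (x 1)) * (\<theta> ^ m)\<^sup>2"
proof -
  define y where "y m v = (1 / \<theta> ^ m) * x m v" for m v
  define a where "a = 1 / (q * \<theta>)"
  define b where "b = 1 / (q * \<theta>\<^sup>2)"
  have pos: "\<theta> > 0" "q > 0" using \<theta> q_ge by auto
  have sq: "\<theta>\<^sup>2 \<ge> 9 / 16" using mult_mono[of "3/4" \<theta> "3/4" \<theta>] \<theta> by (simp add: power2_eq_square)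
  have "q * \<theta>\<^sup>2 \<ge> 2 * (9 / 16)" using sq q_ge by (intro mult_mono) auto
  then have b: "b \<le> 1" by (simp add: b_def)
  have ab: "a > 0" "a * \<Lambda> < 1 + b"
    using \<theta> pos by (auto simp: a_def b_def field_simps power2_eq_square)
  have Adj_y: "Adj (y m) v = (1 / \<theta> ^ m) * Adj (x m) v" for m v
    by (simp add: Adj_def y_def sum_divide_distrib)
  have rec_y: "y (Suc (Suc m)) v = a * Adj (y (Suc m)) v - b * y m v" if "v \<in> V" for m v
  proof -
    have "x (Suc (Suc m)) v = (Adj (x (Suc m)) v - x m v) / q"
      using rec[OF that, of m] pos by (simp add: field_simps)
    then show ?thesis
      using pos by (simp add: y_def Adj_y a_def b_def field_simps power2_eq_square)
  qed
  have mean_y: "(\<Sum>v\<in>V. y m v) = 0" for m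
    using mean[of m] by (simp add: y_def sum_divide_distrib[symmetric])
  have ip_y: "ip (y m) (y m) = (1 / \<theta> ^ m)\<^sup>2 * ip (x m) (x m)" for m
    unfolding y_def by (rule ip_scale)
  have "ip (y 1) (y 1) \<le> 2 * ip (x 1) (x 1)"
  proof -
    have "1 \<le> 2 * \<theta>\<^sup>2" using sq by linarith
    from mult_right_mono[OF this ip_self_nonneg[of "x 1"]]
    show ?thesis using pos unfolding ip_y by (simp add: field_simps)
  qed
  moreover have "ip (y 0) (y 0) \<le> 2 * ip (x 0) (x 0)"
    using ip_self_nonneg[of "x 0"] by (auto simp: ip_y simp del: ip_self_nonneg)
  ultimately have "ip (y 0) (y 0) + ip (y 1) (y 1) \<le> 2 * (ip (x 0) (x 0) + ip (x 1) (x 1))"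
    by argo
  then have "2 * (1 + b) * (ip (y 0) (y 0) + ip (y 1) (y 1)) \<le> 4 * (2 * (ip (x 0) (x 0) + ip (x 1) (x 1)))"
    using b by (intro mult_mono) auto
  with two_term_recurrence_bounded[where y = y, OF gap rec_y mean_y ab(1) b ab(2), of m]
  have "(1 + b - a * \<Lambda>) * ip (y m) (y m) \<le> 8 * (ip (x 0) (x 0) + ip (x 1) (x 1))"
    by linarith
  then have "(1 + b - a * \<Lambda>) * ip (y m) (y m) * (\<theta> ^ m)\<^sup>2
    \<le> 8 * (ip (x 0) (x 0) + ip (x 1) (x 1)) * (\<theta> ^ m)\<^sup>2"
    by (rule mult_right_mono) simp
  moreover have "ip (y m) (y m) * (\<theta> ^ m)\<^sup>2 = ip (x m) (x m)"
    using pos by (simp add: ip_y field_simps)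
  moreover have "a * \<Lambda> = \<Lambda> / (q * \<theta>)" by (simp add: a_def)
  ultimately show ?thesis by (simp add: b_def mult.assoc)
qed

section \<open>The non-backtracking operator on arcs\<close>

lemma nbop_mult_q:
  assumes "x \<in> N y"
  shows "q * nbop \<phi> x y = (\<Sum>z\<in>N y. \<phi> y z) - \<phi> y x"
proof -
  have "q * nbop \<phi> x y = (\<Sum>z\<in>N y - {x}. \<phi> y z)"
    using q_ge by (simp add: nbop_def)
  then show ?thesis
    using assms by (simp add: sum_diff1)
qed

text \<open>Summing the iterates over the arcs leaving a vertex gives vertex functions that obey the
  two-term recurrence of the non-backtracking polynomials of the adjacency operator, so they decay.
  The identity \<open>F_Suc\<close> then recovers the value on each single arc from these
  sums.\<close>

lemma nbop_pow_mean_zero_le: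
  assumes gap: "spectral_gap \<Lambda>" "\<Lambda> > 0" "\<Lambda> < d"
    and \<theta>: "3 / 4 \<le> \<theta>" "\<theta> < 1" "\<Lambda> < q * \<theta> + 1 / \<theta>"
    and \<gamma>: "\<gamma> = 1 + 1 / (q * \<theta>\<^sup>2) - \<Lambda> / (q * \<theta>)"
    and K: "K \<ge> 1" "16 * (real d)\<^sup>2 / \<gamma> \<le> K\<^sup>2"
    and mean: "(\<Sum>v\<in>V. f v) = 0" and y: "y \<in> N x"
  shows "\<bar>(nbop ^^ m) (\<lambda>_. f) x y\<bar> \<le> 2 * K * \<theta> ^ m * sqrt (ip f f)"
proof -
  define F where "F m = (nbop ^^ m) (\<lambda>_. f)" for m
  \<comment> \<open>The index is shifted by one: \<open>X (Suc m)\<close> belongs to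
    \<open>F m\<close>. The value at 0 is the one that makes \<open>in_sum\<close>, and with it the
    recurrence, valid from the start.\<close>
  define X where "X m = (case m of 0 \<Rightarrow> (\<lambda>v. real d * f v) | Suc m \<Rightarrow> (\<lambda>v. \<Sum>z\<in>N v. F m v z))" for m
  have F_Suc: "q * F (Suc m) x y = X (Suc m) y - F m y x" if "x \<in> N y" for m x y
    using nbop_mult_q[OF that, of "F m"] by (simp add: F_def X_def)
  \<comment> \<open>The sum over incoming arcs equals the outgoing sum one step earlier. This closes
    the recurrence on vertex functions.\<close>
  have in_sum: "(\<Sum>x\<in>N y. F m x y) = X m y" if "y \<in> V" for m y
  proof (cases m)
    case 0
    then show ?thesis using card_nbrs[OF that] by (simp add: F_def X_def)
  next
    case (Suc k)
    have "q * (\<Sum>x\<in>N y. F (Suc k) x y) = (\<Sum>x\<in>N y. X (Suc k) y - F k y x)"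
      unfolding sum_distrib_left by (intro sum.cong refl F_Suc)
    also have "\<dots> = real d * X (Suc k) y - X (Suc k) y"
      using card_nbrs[OF that] by (simp add: sum_subtractf X_def)
    also have "\<dots> = q * X (Suc k) y" by (simp add: q_def algebra_simps)
    finally show ?thesis using q_ge Suc by simp
  qed
  have rec: "q * X (Suc (Suc m)) v = Adj (X (Suc m)) v - X m v" if "v \<in> V" for m v
  proof -
    have "q * X (Suc (Suc m)) v = (\<Sum>y\<in>N v. X (Suc m) y - F m y v)"
      unfolding X_def by (simp add: sum_distrib_left F_Suc nbrs_sym X_def)
    then show ?thesis using in_sum[OF that, of m] by (simp add: sum_subtractf Adj_def)
  qed
  have X1: "X 1 = Adj f" by (simp add: fun_eq_iff X_def F_def Adj_def)
  have X0: "X 0 = (\<lambda>v. real d * f v)" by (simp add: X_def)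
  have meanX: "(\<Sum>v\<in>V. X m v) = 0" for m
  proof (induction m rule: less_induct)
    case (less m)
    consider "m = 0" | "m = 1" | k where "m = Suc (Suc k)"
      by (metis One_nat_def not0_implies_Suc)
    then show ?case
    proof cases
      case 3
      have "q * (\<Sum>v\<in>V. X m v) = (\<Sum>v\<in>V. Adj (X (Suc k)) v - X k v)"
        unfolding sum_distrib_left 3 by (intro sum.cong refl rec)
      also have "\<dots> = 0"
        using less[of k] less[of "Suc k"] sum_Adj[of "X (Suc k)"] 3 by (simp add: sum_subtractf sum_Adj)
      finally show ?thesis using q_ge by simp
    qed (use mean in \<open>auto simp: X0 X1[simplified] sum_Adj sum_distrib_left[symmetric]\<close>)
  qed
  have pos: "\<theta> > 0" "q > 0" using \<theta> q_ge by auto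
  then have "\<gamma> * (q * \<theta>) = q * \<theta> + 1 / \<theta> - \<Lambda>"
    unfolding \<gamma> by (simp add: field_simps power2_eq_square)
  then have \<gamma>_pos: "\<gamma> > 0" using \<theta> pos by (intro zero_less_mult_pos2[of \<gamma> "q * \<theta>"]) auto
  have X_bound: "\<bar>X m v\<bar> \<le> K * \<theta> ^ m * sqrt (ip f f)" if "v \<in> V" for m v
  proof -
    have "ip (X 1) (X 1) \<le> \<Lambda>\<^sup>2 * ip f f"
      using gap mean unfolding X1 by (simp add: spectral_gap_def)
    also have "\<dots> \<le> (real d)\<^sup>2 * ip f f"
      using gap by (intro mult_right_mono power_mono) auto
    finally have "ip (X 0) (X 0) + ip (X 1) (X 1) \<le> 2 * (real d)\<^sup>2 * ip f f"
      using ip_scale[of "real d" f] by (simp add: X0 mult.commute)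
    then have "8 * (ip (X 0) (X 0) + ip (X 1) (X 1)) * (\<theta> ^ m)\<^sup>2
      \<le> 8 * (2 * (real d)\<^sup>2 * ip f f) * (\<theta> ^ m)\<^sup>2"
      by (intro mult_right_mono mult_left_mono) auto
    with two_term_recurrence_decay[where x = X, OF gap(1,2) rec meanX \<theta>, of m]
    have "\<gamma> * ip (X m) (X m) \<le> 16 * (real d)\<^sup>2 * (\<theta> ^ m)\<^sup>2 * ip f f"
      unfolding \<gamma> by (simp add: mult_ac)
    then have "ip (X m) (X m) \<le> (16 * (real d)\<^sup>2 / \<gamma>) * (\<theta> ^ m)\<^sup>2 * ip f f"
      using \<gamma>_pos by (simp add: field_simps)
    also have "\<dots> \<le> K\<^sup>2 * (\<theta> ^ m)\<^sup>2 * ip f f"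
      using K by (intro mult_right_mono) auto
    finally have "sqrt (ip (X m) (X m)) \<le> sqrt ((K * \<theta> ^ m)\<^sup>2 * ip f f)"
      by (simp add: power_mult_distrib)
    also have "\<dots> = K * \<theta> ^ m * sqrt (ip f f)"
      using K pos by (simp add: real_sqrt_mult)
    finally show ?thesis using abs_le_sqrt_ip[OF that, of "X m"] by linarith
  qed
  have "\<bar>F m x y\<bar> \<le> 2 * K * \<theta> ^ m * sqrt (ip f f)" if "y \<in> N x" for x y
    using that
  proof (induction m arbitrary: x y)
    case 0
    then have "y \<in> V" using nbrs_subset by blast
    moreover have "1 * sqrt (ip f f) \<le> 2 * K * sqrt (ip f f)"
      using K by (intro mult_right_mono) auto
    ultimately show ?case using abs_le_sqrt_ip[of y f] by (simp add: F_def)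
  next
    case (Suc m)
    define s where "s = sqrt (ip f f)"
    have s: "s \<ge> 0" by (simp add: s_def)
    have "x \<in> N y" "y \<in> V" using Suc.prems nbrs_sym nbrs_subset by blast+
    then have "q * F (Suc m) x y = X (Suc m) y - F m y x" "\<bar>F m y x\<bar> \<le> 2 * K * \<theta> ^ m * s"
      using F_Suc Suc.IH by (auto simp: s_def)
    with X_bound[OF \<open>y \<in> V\<close>, of "Suc m"]
    have "\<bar>q * F (Suc m) x y\<bar> \<le> K * \<theta> ^ Suc m * s + 2 * K * \<theta> ^ m * s"
      unfolding s_def by linarith
    also have "\<dots> = (\<theta> + 2) * (K * \<theta> ^ m * s)"
      by (simp add: algebra_simps)
    \<comment> \<open>Since \<open>\<theta> \<ge> 3 / 4\<close>, \<open>\<theta> + 2\<close> is at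
      most \<open>4 * \<theta>\<close>; dividing by \<open>q \<ge> 2\<close> then reproduces the
      constant \<open>2 * K\<close>, so nothing is lost from step to step.\<close>
    also have "\<dots> \<le> (4 * \<theta>) * (K * \<theta> ^ m * s)"
      using \<theta> K s pos by (intro mult_right_mono) auto
    finally have "q * \<bar>F (Suc m) x y\<bar> \<le> 4 * (K * \<theta> ^ Suc m * s)"
      using pos by (simp add: abs_mult mult_ac)
    moreover have "2 * \<bar>F (Suc m) x y\<bar> \<le> q * \<bar>F (Suc m) x y\<bar>"
      using q_ge by (intro mult_right_mono) auto
    ultimately show ?case by (simp add: s_def)
  qed
  then show ?thesis using y by (simp add: F_def)
qed

lemma nbop_pow_const:
  assumes "y \<in> N x"
  shows "(nbop ^^ m) (\<lambda>_ _. c) x y = c"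
  using assms
proof (induction m arbitrary: x y)
  case (Suc m)
  have xy: "x \<in> N y" "y \<in> V" using Suc.prems nbrs_sym nbrs_subset by blast+
  have "q * nbop ((nbop ^^ m) (\<lambda>_ _. c)) x y = (\<Sum>z\<in>N y. c) - c"
    using Suc.IH nbrs_sym xy by (simp add: nbop_mult_q)
  also have "\<dots> = q * c"
    using card_nbrs[OF xy(2)] by (simp add: q_def algebra_simps)
  finally show ?case using q_ge by simp
qed simp

lemma nbop_pow_add:
  "(nbop ^^ m) (\<lambda>x y. \<phi> x y + \<psi> x y) x y = (nbop ^^ m) \<phi> x y + (nbop ^^ m) \<psi> x y"
proof (induction m arbitrary: x y)
  case (Suc m)
  then show ?case by (simp add: nbop_def sum.distrib add_divide_distrib)
qed simp

lemma ip_centered_le: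
  fixes f :: "'a \<Rightarrow> real" and c :: real
  assumes "(\<Sum>v\<in>V. f v) = card V * c"
  shows "ip (\<lambda>v. f v - c) (\<lambda>v. f v - c) \<le> ip f f"
proof -
  have "ip (\<lambda>v. f v - c) (\<lambda>v. f v - c) = ip f f - 2 * c * (\<Sum>v\<in>V. f v) + card V * c\<^sup>2"
    by (simp add: ip_def algebra_simps sum.distrib sum_subtractf sum_distrib_left power2_eq_square)
  also have "\<dots> = ip f f - card V * c\<^sup>2" by (simp add: assms power2_eq_square)
  finally show ?thesis by simp
qed

text \<open>The error holds for every starting arc but is measured in the unnormalised Euclidean
  norm. For bounded \<open>f\<close> this costs a factor of order \<open>sqrt (card V)\<close>,
  which the exponential rate absorbs; for the indicator of one vertex it costs nothing.\<close>

definition mixing :: "real \<Rightarrow> real \<Rightarrow> bool" where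
  "mixing C \<theta> \<longleftrightarrow> (\<forall>f m x y. y \<in> N x \<longrightarrow>
     \<bar>(nbop ^^ m) (\<lambda>_. f) x y - (\<Sum>v\<in>V. f v) / card V\<bar> \<le> C * \<theta> ^ m * sqrt (ip f f))"

lemma card_verts_pos: "card V > 0"
  using verts_nonempty pair_finite_verts by (simp add: card_gt_0_iff)

end

text \<open>The constants are fixed before the graph, from \<open>d\<close> and
  \<open>\<Lambda>\<close> alone. This uniformity lets the graph vary with its number of
  vertices.\<close>

lemma uniform_mixing:
  fixes \<Lambda> :: real
  assumes "d \<ge> 3" "\<Lambda> > 0" "\<Lambda> < real d"
  obtains C \<theta> where "C \<ge> 0" "0 < \<theta>" "\<theta> < 1"
    "\<And>G :: 'a pair_pre_digraph. regular_graph G d \<Longrightarrow> regular_graph.spectral_gap G \<Lambda>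
      \<Longrightarrow> regular_graph.mixing G d C \<theta>"
proof -
  define p where "p = real d - 1"
  have p: "p \<ge> 2" using assms by (simp add: p_def)
  \<comment> \<open>The second argument solves
    \<open>p * \<theta> + 1 = (d + \<Lambda>) / 2\<close>, a value strictly between
    \<open>\<Lambda>\<close> and \<open>d\<close>. The first is the lower bound required by the
    decay estimate.\<close>
  define \<theta> where "\<theta> = max (3 / 4) ((1 + (\<Lambda> - 1) / p) / 2)"
  have mid: "p * ((1 + (\<Lambda> - 1) / p) / 2) = (real d + \<Lambda>) / 2 - 1"
    using p by (simp add: field_simps) (simp add: p_def algebra_simps)
  have "(\<Lambda> - 1) / p < 1" using assms p by (simp add: p_def)
  then have \<theta>: "3 / 4 \<le> \<theta>" "\<theta> < 1"
    by (auto simp: \<theta>_def)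
  have "\<Lambda> < p * ((1 + (\<Lambda> - 1) / p) / 2) + 1"
    using assms by (subst mid) (simp add: p_def)
  also have "\<dots> \<le> p * \<theta> + 1"
    using p by (intro add_right_mono mult_left_mono) (auto simp: \<theta>_def)
  also have "\<dots> \<le> p * \<theta> + 1 / \<theta>" using \<theta> by simp
  finally have \<Lambda>: "\<Lambda> < p * \<theta> + 1 / \<theta>" .
  define \<gamma> where "\<gamma> = 1 + 1 / (p * \<theta>\<^sup>2) - \<Lambda> / (p * \<theta>)"
  define M where "M = 16 * (real d)\<^sup>2 / \<gamma>"
  define K where "K = max 1 (sqrt \<bar>M\<bar>)"
  have K: "K \<ge> 1" by (simp add: K_def)
  have "sqrt \<bar>M\<bar> \<le> K" by (simp add: K_def)
  then have "(sqrt \<bar>M\<bar>)\<^sup>2 \<le> K\<^sup>2" by (intro power_mono) auto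
  then have K2: "16 * (real d)\<^sup>2 / \<gamma> \<le> K\<^sup>2" unfolding M_def[symmetric] by simp
  show thesis
  proof (rule that[of "2 * K" \<theta>])
    fix G :: "'a pair_pre_digraph"
    assume "regular_graph G d" and gap: "regular_graph.spectral_gap G \<Lambda>"
    then interpret regular_graph G d by simp
    have q_eq: "q = p" by (simp add: q_def p_def)
    show "mixing (2 * K) \<theta>"
      unfolding mixing_def
    proof (intro allI impI)
      fix f :: "'a \<Rightarrow> real" and m x y assume y: "y \<in> N x"
      define c where "c = (\<Sum>v\<in>V. f v) / card V"
      have sum_f: "(\<Sum>v\<in>V. f v) = card V * c"
        using card_verts_pos by (simp add: c_def)
      then have mean: "(\<Sum>v\<in>V. f v - c) = 0" by (simp add: sum_subtractf)
      have "(nbop ^^ m) (\<lambda>_. f) x y = (nbop ^^ m) (\<lambda>_ v. f v - c) x y + c"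
        using nbop_pow_add[of m "\<lambda>_ v. f v - c" "\<lambda>_ _. c" x y] nbop_pow_const[OF y] by simp
      then have "\<bar>(nbop ^^ m) (\<lambda>_. f) x y - c\<bar> = \<bar>(nbop ^^ m) (\<lambda>_ v. f v - c) x y\<bar>" by simp
      also have "\<dots> \<le> 2 * K * \<theta> ^ m * sqrt (ip (\<lambda>v. f v - c) (\<lambda>v. f v - c))"
        using assms \<theta> \<Lambda> gap K K2 mean y
        by (intro nbop_pow_mean_zero_le[where \<Lambda> = \<Lambda> and \<gamma> = \<gamma>]) (auto simp: q_eq \<gamma>_def)
      also have "\<dots> \<le> 2 * K * \<theta> ^ m * sqrt (ip f f)"
        using K \<theta> ip_centered_le[OF sum_f] by (intro mult_left_mono) auto
      finally show "\<bar>(nbop ^^ m) (\<lambda>_. f) x y - (\<Sum>v\<in>V. f v) / card V\<bar> \<le> 2 * K * \<theta> ^ m * sqrt (ip f f)"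
        by (simp add: c_def)
    qed
  qed (use K \<theta> in auto)
qed

section \<open>The spectral gap of the adjacency operator\<close>

lemma ndl_graph_regular:
  assumes "ndl_graph n d lam G" "d \<ge> 3" "n > 0"
  shows "regular_graph G d"
proof -
  interpret pair_graph G using assms by (simp add: ndl_graph_def)
  show ?thesis
  proof
    show "pverts G \<noteq> {}" using assms by (auto simp: ndl_graph_def)
    show "card (nbrs G v) = d" if "v \<in> pverts G" for v
    proof -
      have "out_arcs G v = Pair v ` nbrs G v"
        by (auto simp: out_arcs_def nbrs_def)
      then have "out_degree G v = card (nbrs G v)"
        by (simp add: out_degree_def card_image inj_on_def)
      then show ?thesis using assms that by (simp add: ndl_graph_def)
    qed
    show "d \<ge> 3" by fact
  qed
qed

context regular_graph
begin

lemma adjacency_mat_carrier: "adjacency_mat G vs \<in> carrier_mat (length vs) (length vs)"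
  by (simp add: adjacency_mat_def)

lemma adjacency_mat_symmetric: "(adjacency_mat G vs)\<^sup>T = adjacency_mat G vs"
  using nbrs_sym by (intro eq_matI) (auto simp: adjacency_mat_def nbrs_def)

lemma sum_nth_vertices:
  assumes "distinct vs" "set vs = V"
  shows "(\<Sum>j = 0..<length vs. f (vs ! j)) = (\<Sum>v\<in>V. f v)"
proof -
  have "bij_betw (\<lambda>j. vs ! j) {0..<length vs} V"
    using assms by (intro bij_betw_nth) auto
  then show ?thesis by (rule sum.reindex_bij_betw)
qed

lemma sum_adjacency_mat_row:
  assumes vs: "distinct vs" "set vs = V" and "i < length vs"
  shows "(\<Sum>j = 0..<length vs. adjacency_mat G vs $$ (i, j) * f (vs ! j)) = Adj f (vs ! i)"
proof -
  have "(\<Sum>j = 0..<length vs. adjacency_mat G vs $$ (i, j) * f (vs ! j))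
      = (\<Sum>j = 0..<length vs. if vs ! j \<in> N (vs ! i) then f (vs ! j) else 0)"
    using \<open>i < length vs\<close> by (intro sum.cong) (auto simp: adjacency_mat_def nbrs_def)
  also have "\<dots> = (\<Sum>w\<in>V. if w \<in> N (vs ! i) then f w else 0)"
    by (rule sum_nth_vertices[OF vs])
  also have "\<dots> = Adj f (vs ! i)"
    using nbrs_subset unfolding Adj_def
    by (intro sum.mono_neutral_cong_right) (auto simp: pair_finite_verts)
  finally show ?thesis .
qed

lemma Adj_pow_eq_adjacency_mat_pow:
  assumes vs: "distinct vs" "set vs = V" and "i < length vs"
  shows "(Adj ^^ k) f (vs ! i) = (\<Sum>j = 0..<length vs. (adjacency_mat G vs ^\<^sub>m k) $$ (i, j) * f (vs ! j))"
  using \<open>i < length vs\<close>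
proof (induction k arbitrary: i)
  case 0
  then show ?case by (simp add: adjacency_mat_def one_mat_def sum.delta if_distrib[of "\<lambda>x. x * _"] cong: if_cong)
next
  case (Suc k)
  define A where "A = adjacency_mat G vs"
  define n where "n = length vs"
  have A: "A \<in> carrier_mat n n" using adjacency_mat_carrier by (simp add: A_def n_def)
  have "A ^\<^sub>m Suc k = A * A ^\<^sub>m k"
    using pow_mat_add[OF A, of 1 k] A by simp
  then have entry: "(A ^\<^sub>m Suc k) $$ (i, j) = (\<Sum>l = 0..<n. A $$ (i, l) * (A ^\<^sub>m k) $$ (l, j))" if "j < n" for j
    using A Suc.prems that by (auto simp: scalar_prod_def n_def intro!: sum.cong)
  have "(Adj ^^ Suc k) f (vs ! i) = (\<Sum>l = 0..<n. A $$ (i, l) * (Adj ^^ k) f (vs ! l))"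
    using sum_adjacency_mat_row[OF vs Suc.prems, of "(Adj ^^ k) f"] by (simp add: A_def n_def)
  also have "\<dots> = (\<Sum>l = 0..<n. \<Sum>j = 0..<n. A $$ (i, l) * (A ^\<^sub>m k) $$ (l, j) * f (vs ! j))"
    using Suc.IH by (simp add: A_def n_def sum_distrib_left mult_ac)
  also have "\<dots> = (\<Sum>j = 0..<n. (A ^\<^sub>m Suc k) $$ (i, j) * f (vs ! j))"
    by (subst sum.swap) (simp add: entry sum_distrib_right del: pow_mat.simps)
  finally show ?case by (simp add: A_def n_def)
qed

text \<open>Subtracting a constant from all matrix entries does not change the image of a mean-zero
  function. Cauchy-Schwarz in each row then bounds the image by the Frobenius norm of the centred
  power, that is, by the power sum of the eigenvalues other than the leading one. There are at most
  \<open>n\<close> of these, whence the factor \<open>n\<close>.\<close>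

lemma ip_Adj_pow_le:
  assumes ndl: "ndl_graph n d lam G" and "n \<ge> 2" and mean: "(\<Sum>v\<in>V. f v) = 0"
  shows "ip ((Adj ^^ k) f) ((Adj ^^ k) f) \<le> n * lam ^ (2 * k) * ip f f"
proof -
  obtain vs ls where vs: "distinct vs" "set vs = V"
    and ord: "ordered_eigenvalues (adjacency_mat G vs) ls"
    and ls: "ls ! 0 = real d" "Max ((\<lambda>i. \<bar>ls ! i\<bar>) ` {1..<n}) = lam"
    using ndl unfolding ndl_graph_def by blast
  have n: "length vs = n"
    using ndl vs distinct_card[OF vs(1)] by (simp add: ndl_graph_def)
  define A where "A = adjacency_mat G vs"
  have A: "A \<in> carrier_mat n n" "A\<^sup>T = A"
    using adjacency_mat_carrier[of vs] adjacency_mat_symmetric n by (auto simp: A_def)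
  have row: "(\<Sum>j = 0..<n. A $$ (i, j)) = real d" if "i < n" for i
    using sum_adjacency_mat_row[OF vs, of i "\<lambda>_. 1"] card_nbrs[of "vs ! i"] nth_mem[of i vs] vs that n
    by (auto simp: Adj_def A_def)
  have "\<bar>ls ! i\<bar> \<le> lam" if "i \<in> {1..<n}" for i
    unfolding ls(2)[symmetric] using that by (intro Max_ge) auto
  then have lam: "(ls ! i) ^ (2 * k) \<le> lam ^ (2 * k)" if "i \<in> {1..<n}" for i
    using that by (metis power_mono abs_ge_zero power_even_abs dvd_triv_left)
  have "mat_trace (A ^\<^sub>m (2 * k)) = (\<Sum>i = 0..<n. (ls ! i) ^ (2 * k))"
    using A ord by (intro mat_trace_pow_eq_sum_eigenvalues) (auto simp: ordered_eigenvalues_def A_def)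
  also have "\<dots> = real d ^ (2 * k) + (\<Sum>i = 1..<n. (ls ! i) ^ (2 * k))"
    using \<open>n \<ge> 2\<close> by (simp add: sum.atLeast_Suc_lessThan ls)
  also have "(\<Sum>i = 1..<n. (ls ! i) ^ (2 * k)) \<le> (\<Sum>i = 1..<n. lam ^ (2 * k))"
    by (rule sum_mono) (rule lam)
  also have "\<dots> \<le> n * lam ^ (2 * k)"
    by (simp add: mult_right_mono)
  finally have tr: "mat_trace (A ^\<^sub>m (2 * k)) - real d ^ (2 * k) \<le> n * lam ^ (2 * k)" by simp
  define c where "c = real d ^ k / n"
  have mean': "(\<Sum>j = 0..<n. f (vs ! j)) = 0"
    using sum_nth_vertices[OF vs, of f] n mean by simp
  have sq: "(\<Sum>j = 0..<n. (f (vs ! j))\<^sup>2) = ip f f"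
    using sum_nth_vertices[OF vs, of "\<lambda>v. (f v)\<^sup>2"] n by (simp add: ip_def power2_eq_square)
  have "ip ((Adj ^^ k) f) ((Adj ^^ k) f) = (\<Sum>i = 0..<n. ((Adj ^^ k) f (vs ! i))\<^sup>2)"
    using sum_nth_vertices[OF vs, of "\<lambda>v. ((Adj ^^ k) f v)\<^sup>2"] n by (simp add: ip_def power2_eq_square)
  also have "\<dots> \<le> (\<Sum>i = 0..<n. (\<Sum>j = 0..<n. ((A ^\<^sub>m k) $$ (i, j) - c)\<^sup>2) * ip f f)"
  proof (rule sum_mono)
    fix i assume "i \<in> {0..<n}"
    then have "(Adj ^^ k) f (vs ! i) = (\<Sum>j = 0..<n. (A ^\<^sub>m k) $$ (i, j) * f (vs ! j))"
      using Adj_pow_eq_adjacency_mat_pow[OF vs] n by (simp add: A_def)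
    also have "\<dots> = (\<Sum>j = 0..<n. ((A ^\<^sub>m k) $$ (i, j) - c) * f (vs ! j))"
      by (simp add: left_diff_distrib sum_subtractf sum_distrib_left[symmetric] mean')
    finally show "((Adj ^^ k) f (vs ! i))\<^sup>2 \<le> (\<Sum>j = 0..<n. ((A ^\<^sub>m k) $$ (i, j) - c)\<^sup>2) * ip f f"
      using Cauchy_Schwarz_ineq_sum[of "\<lambda>j. (A ^\<^sub>m k) $$ (i, j) - c" "\<lambda>j. f (vs ! j)" "{0..<n}"]
      by (simp add: sq)
  qed
  also have "\<dots> = (mat_trace (A ^\<^sub>m (2 * k)) - real d ^ (2 * k)) * ip f f"
    using sum_centered_pow_entries_square[OF A _ row, of k] \<open>n \<ge> 2\<close>
    by (simp add: c_def sum_distrib_right[symmetric])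
  also have "\<dots> \<le> n * lam ^ (2 * k) * ip f f"
    using tr by (intro mult_right_mono) auto
  finally show ?thesis .
qed

lemma ip_square_le: "(ip f g)\<^sup>2 \<le> ip f f * ip g g"
  using Cauchy_Schwarz_ineq_sum[of f g V] by (simp add: ip_def power2_eq_square)

text \<open>
  By self-adjointness \<open>\<bar>A\<^sup>k f\<bar>\<^sup>2\<close> is log-convex in \<open>k\<close>, so its growth rate, bounded by the trace,
  bounds its very first step; the factor \<open>n\<close> lost in the trace bound disappears.
\<close>

lemma ndl_graph_spectral_gap:
  assumes ndl: "ndl_graph n d lam G" and "n \<ge> 2"
  shows "spectral_gap (max lam 1)"
  unfolding spectral_gap_def
proof (intro allI impI)
  fix f :: "'a \<Rightarrow> real" assume mean: "(\<Sum>v\<in>V. f v) = 0"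
  define \<Lambda> where "\<Lambda> = max lam 1"
  define c where "c k = ip ((Adj ^^ k) f) ((Adj ^^ k) f)" for k
  have \<Lambda>: "\<Lambda> \<ge> 1" by (simp add: \<Lambda>_def)
  have lam: "0 \<le> lam"
  proof -
    obtain ls :: "real list" where "Max ((\<lambda>i. \<bar>ls ! i\<bar>) ` {1..<n}) = lam"
      using ndl unfolding ndl_graph_def by blast
    moreover have "\<bar>ls ! 1\<bar> \<le> Max ((\<lambda>i. \<bar>ls ! i\<bar>) ` {1..<n})"
      using \<open>n \<ge> 2\<close> by (intro Max_ge) auto
    ultimately show ?thesis by linarith
  qed
  have growth: "c k \<le> n * (\<Lambda>\<^sup>2) ^ k * c 0" for k
  proof -
    have "c k \<le> n * lam ^ (2 * k) * c 0"
      using ip_Adj_pow_le[OF ndl \<open>n \<ge> 2\<close> mean] by (simp add: c_def)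
    also have "\<dots> \<le> n * \<Lambda> ^ (2 * k) * c 0"
      using lam by (intro mult_right_mono mult_left_mono power_mono) (auto simp: \<Lambda>_def c_def)
    finally show ?thesis by (simp add: power_mult)
  qed
  show "ip (Adj f) (Adj f) \<le> (max lam 1)\<^sup>2 * ip f f"
  proof (rule ccontr)
    assume "\<not> ?thesis"
    then have c1: "c 1 > \<Lambda>\<^sup>2 * c 0" by (simp add: c_def \<Lambda>_def)
    have "c 0 \<noteq> 0" using growth[of 1] c1 by auto
    then have c0: "c 0 > 0" by (simp add: c_def less_le)
    define r where "r = c 1 / c 0"
    have r: "r > \<Lambda>\<^sup>2" using c1 c0 by (simp add: r_def field_simps)
    then have "r > 0" using \<Lambda> by (smt (verit) zero_le_power2)
    have "r ^ k * c 0 \<le> c k" for k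
    proof (rule log_convex_ge_power)
      \<comment> \<open>Moving one adjacency operator across the inner product writes
        \<open>c (Suc k)\<close> as the inner product of the \<open>k\<close>-th and the
        \<open>(k + 2)\<close>-nd iterate; Cauchy-Schwarz applies.\<close>
      show "(c (Suc k))\<^sup>2 \<le> c k * c (Suc (Suc k))" for k
        using ip_square_le[of "(Adj ^^ k) f" "(Adj ^^ Suc (Suc k)) f"] by (simp add: c_def ip_Adj)
    qed (use c0 \<open>r > 0\<close> in \<open>auto simp: r_def c_def\<close>)
    then have "r ^ k * c 0 \<le> n * (\<Lambda>\<^sup>2) ^ k * c 0" for k
      using growth order_trans by blast
    then have "r ^ k \<le> n * (\<Lambda>\<^sup>2) ^ k" for k
      using c0 by (meson mult_le_cancel_right_pos)
    then have "(r / \<Lambda>\<^sup>2) ^ k \<le> n" for k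
      using \<Lambda> by (simp add: power_divide divide_le_eq)
    moreover have "r / \<Lambda>\<^sup>2 > 1" using r \<Lambda> by simp
    ultimately show False
      by (meson real_arch_pow not_le)
  qed
qed

end

section \<open>The Markov property and short returns\<close>

lemma expectation_pmf_cong:
  fixes f g :: "'b \<Rightarrow> real"
  shows "(\<And>x. x \<in> set_pmf p \<Longrightarrow> f x = g x) \<Longrightarrow> measure_pmf.expectation p f = measure_pmf.expectation p g"
  by (intro integral_cong_AE) (auto simp: AE_measure_pmf_iff)

lemma expectation_pmf_mono:
  fixes f g :: "'b \<Rightarrow> real"
  assumes "finite (set_pmf p)" "\<And>x. x \<in> set_pmf p \<Longrightarrow> f x \<le> g x"
  shows "measure_pmf.expectation p f \<le> measure_pmf.expectation p g"
  using assms by (intro integral_mono_AE) (auto simp: AE_measure_pmf_iff integrable_measure_pmf_finite)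

declare nb_walk.simps(2) [simp del]

definition nb_path :: "'a pair_pre_digraph \<Rightarrow> nat \<Rightarrow> 'a list \<Rightarrow> bool" where
  "nb_path G k ws \<longleftrightarrow> length ws = Suc k \<and> set ws \<subseteq> pverts G \<and> (\<forall>i<k. ws ! Suc i \<in> nbrs G (ws ! i))
    \<and> (\<forall>i. Suc (Suc i) \<le> k \<longrightarrow> ws ! Suc (Suc i) \<noteq> ws ! i)"

definition nb_next :: "'a pair_pre_digraph \<Rightarrow> nat \<Rightarrow> 'a list \<Rightarrow> 'a set" where
  "nb_next G k ws = {v. (ws ! k, v) \<in> parcs G \<and> (k \<ge> 1 \<longrightarrow> v \<noteq> ws ! (k - 1))}"

context regular_graph
begin

lemma nb_next_Suc: "k \<ge> 1 \<Longrightarrow> nb_next G k ws = N (ws ! k) - {ws ! (k - 1)}"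
  by (auto simp: nb_next_def nbrs_def)

lemma finite_nb_next [simp]: "finite (nb_next G k ws)"
  by (rule finite_subset[OF _ finite_nbrs]) (auto simp: nb_next_def nbrs_def)

lemma card_nb_next:
  assumes "nb_path G k ws" "k \<ge> 1"
  shows "real (card (nb_next G k ws)) = q"
proof -
  obtain l where k: "k = Suc l" using assms by (cases k) auto
  have "ws ! k \<in> V" "ws ! k \<in> N (ws ! l)"
    using assms k nth_mem[of k ws] by (auto simp: nb_path_def)
  then have "card (N (ws ! k)) = d" "ws ! l \<in> N (ws ! k)"
    using card_nbrs nbrs_sym by auto
  then show ?thesis
    using d_ge by (simp add: nb_next_Suc k q_def)
qed

lemma nb_next_nonempty:
  assumes "nb_path G k ws"
  shows "nb_next G k ws \<noteq> {}"
proof (cases "k = 0")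
  case True
  then have "ws ! 0 \<in> V" using assms nth_mem[of 0 ws] by (auto simp: nb_path_def)
  then have "card (N (ws ! 0)) \<noteq> 0" using card_nbrs d_ge by simp
  then have "N (ws ! 0) \<noteq> {}" by (metis card.empty)
  then show ?thesis using True by (auto simp: nb_next_def nbrs_def)
next
  case False
  then have "real (card (nb_next G k ws)) \<noteq> 0" using card_nb_next[OF assms] q_ge by simp
  then show ?thesis by auto
qed

lemma nb_path_append:
  assumes ws: "nb_path G k ws" and v: "v \<in> nb_next G k ws"
  shows "nb_path G (Suc k) (ws @ [v])"
proof -
  have len: "length ws = Suc k" using ws by (simp add: nb_path_def)
  have vN: "v \<in> N (ws ! k)" using v by (simp add: nb_next_def nbrs_def)
  have "(ws @ [v]) ! Suc i \<in> N ((ws @ [v]) ! i)" if "i < Suc k" for i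
    using that vN ws len by (cases "i = k") (auto simp: nth_append nb_path_def)
  moreover have "(ws @ [v]) ! Suc (Suc i) \<noteq> (ws @ [v]) ! i" if "Suc (Suc i) \<le> Suc k" for i
    using that v ws len by (cases "Suc i = k") (auto simp: nth_append nb_path_def nb_next_def)
  ultimately show ?thesis
    using len ws vN nbrs_subset[of "ws ! k"] by (auto simp: nb_path_def)
qed

context
  fixes u assumes u: "u \<in> V"
begin

abbreviation "walk \<equiv> nb_walk G u"
abbreviation "expec k \<equiv> measure_pmf.expectation (walk k)"

lemma set_nb_walk:
  "finite (set_pmf (walk k)) \<and> (\<forall>ws \<in> set_pmf (walk k). nb_path G k ws)"
proof (induction k)
  case 0
  show ?case using u by (simp add: nb_path_def)
next
  case (Suc k)
  have "set_pmf (walk (Suc k)) = (\<Union>ws\<in>set_pmf (walk k). (\<lambda>v. ws @ [v]) ` nb_next G k ws)"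
  proof -
    have "set_pmf (walk (Suc k)) = (\<Union>ws\<in>set_pmf (walk k). (\<lambda>v. ws @ [v]) ` set_pmf (pmf_of_set (nb_next G k ws)))"
      unfolding nb_walk.simps nb_next_def[symmetric] by simp
    also have "\<dots> = (\<Union>ws\<in>set_pmf (walk k). (\<lambda>v. ws @ [v]) ` nb_next G k ws)"
      using Suc nb_next_nonempty by (intro SUP_cong) (auto simp: set_pmf_of_set)
    finally show ?thesis .
  qed
  then show ?case using Suc nb_path_append by auto
qed

lemmas finite_nb_walk [simp] = set_nb_walk[THEN conjunct1]
lemmas nb_path_walk = set_nb_walk[THEN conjunct2, rule_format]

lemma integrable_nb_walk [simp]: "integrable (walk k) (f :: _ \<Rightarrow> real)"
  by (simp add: integrable_measure_pmf_finite)

lemma expec_Suc: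
  fixes f :: "'a list \<Rightarrow> real"
  shows "expec (Suc k) f = expec k (\<lambda>ws. (\<Sum>v\<in>nb_next G k ws. f (ws @ [v])) / card (nb_next G k ws))"
proof -
  have inner: "measure_pmf.expectation (map_pmf (\<lambda>v. ws @ [v]) (pmf_of_set (nb_next G k ws))) f
      = (\<Sum>v\<in>nb_next G k ws. f (ws @ [v])) / card (nb_next G k ws)" if "ws \<in> set_pmf (walk k)" for ws
    using nb_next_nonempty[OF nb_path_walk[OF that]] by (simp add: integral_pmf_of_set)
  have "expec (Suc k) f = (\<Sum>ws\<in>set_pmf (walk k). pmf (walk k) ws *\<^sub>R
      measure_pmf.expectation (map_pmf (\<lambda>v. ws @ [v]) (pmf_of_set (nb_next G k ws))) f)"
    unfolding nb_walk.simps nb_next_def[symmetric]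
    using nb_next_nonempty[OF nb_path_walk]
    by (intro pmf_expectation_bind) (auto simp: set_pmf_of_set)
  also have "\<dots> = (\<Sum>ws\<in>set_pmf (walk k). pmf (walk k) ws *\<^sub>R
      ((\<Sum>v\<in>nb_next G k ws. f (ws @ [v])) / card (nb_next G k ws)))"
    using inner by simp
  also have "\<dots> = expec k (\<lambda>ws. (\<Sum>v\<in>nb_next G k ws. f (ws @ [v])) / card (nb_next G k ws))"
    by (intro integral_measure_pmf[symmetric]) auto
  finally show ?thesis .
qed

text \<open>Given the first \<open>a\<close> steps, the remaining \<open>m\<close> steps act on the
  last arc through powers of \<open>nbop\<close>. Keeping \<open>\<Phi>\<close> arbitrary lets the
  induction replace it by its image under \<open>nbop\<close>. The condition
  \<open>a \<ge> 1\<close> ensures that a last arc exists.\<close>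

lemma expec_markov:
  fixes \<Phi> :: "'a list \<Rightarrow> 'a \<Rightarrow> 'a \<Rightarrow> real"
  assumes "a \<ge> 1"
  shows "expec (a + m) (\<lambda>ws. \<Phi> (take (Suc a) ws) (ws ! (a + m - 1)) (ws ! (a + m)))
    = expec a (\<lambda>ws. (nbop ^^ m) (\<Phi> ws) (ws ! (a - 1)) (ws ! a))"
proof (induction m arbitrary: \<Phi>)
  case 0
  show ?case
    unfolding add_0_right
    by (rule expectation_pmf_cong) (use nb_path_walk in \<open>force simp: nb_path_def\<close>)
next
  case (Suc m)
  have "expec (a + Suc m) (\<lambda>ws. \<Phi> (take (Suc a) ws) (ws ! (a + Suc m - 1)) (ws ! (a + Suc m)))
    = expec (a + m) (\<lambda>ws. nbop (\<Phi> (take (Suc a) ws)) (ws ! (a + m - 1)) (ws ! (a + m)))"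
    unfolding add_Suc_right expec_Suc
  proof (rule expectation_pmf_cong)
    fix ws assume "ws \<in> set_pmf (walk (a + m))"
    then have path: "nb_path G (a + m) ws" by (rule nb_path_walk)
    then have "length ws = Suc (a + m)" by (simp add: nb_path_def)
    then show "(\<Sum>v\<in>nb_next G (a + m) ws. \<Phi> (take (Suc a) (ws @ [v])) ((ws @ [v]) ! (Suc (a + m) - 1))
        ((ws @ [v]) ! Suc (a + m))) / card (nb_next G (a + m) ws)
      = nbop (\<Phi> (take (Suc a) ws)) (ws ! (a + m - 1)) (ws ! (a + m))"
      using assms card_nb_next[OF path] by (simp add: nbop_def nb_next_Suc nth_append)
  qed
  also have "\<dots> = expec a (\<lambda>ws. (nbop ^^ m) (nbop (\<Phi> ws)) (ws ! (a - 1)) (ws ! a))"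
    by (rule Suc)
  finally show ?case by (simp add: funpow_swap1)
qed

lemma expec_take:
  fixes f :: "'a list \<Rightarrow> real"
  assumes "a \<le> k"
  shows "expec k (\<lambda>ws. f (take (Suc a) ws)) = expec a f"
  using assms
proof (induction rule: dec_induct)
  case base
  show ?case
    by (rule expectation_pmf_cong) (use nb_path_walk in \<open>force simp: nb_path_def\<close>)
next
  case (step k)
  have "expec (Suc k) (\<lambda>ws. f (take (Suc a) ws)) = expec k (\<lambda>ws. f (take (Suc a) ws))"
    unfolding expec_Suc
  proof (rule expectation_pmf_cong)
    fix ws assume "ws \<in> set_pmf (walk k)"
    then have path: "nb_path G k ws" by (rule nb_path_walk)
    then have "length ws = Suc k" by (simp add: nb_path_def)
    then show "(\<Sum>v\<in>nb_next G k ws. f (take (Suc a) (ws @ [v]))) / card (nb_next G k ws)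
      = f (take (Suc a) ws)"
      using step.hyps nb_next_nonempty[OF path] by simp
  qed
  then show ?case using step by simp
qed

end

text \<open>Induction on the length of the return: shorter returns are already excluded, so the
  vertices of the closed segment are distinct and the segment is a genuine cycle, whose length
  cannot be below the girth.\<close>

lemma nb_path_no_short_return:
  assumes path: "nb_path G k ws" and girth: "enat K \<le> girth G"
    and ij: "i < j" "j \<le> k" "j - i < K"
  shows "ws ! i \<noteq> ws ! j"
  using ij
proof (induction "j - i" arbitrary: i j rule: less_induct)
  case less
  have len: "length ws = Suc k" and step: "\<And>i. i < k \<Longrightarrow> ws ! Suc i \<in> N (ws ! i)"
    using path by (auto simp: nb_path_def)
  show ?case
  proof
    assume eq: "ws ! i = ws ! j"
    define p where "p = map (\<lambda>l. (ws ! l, ws ! Suc l)) [i..<j]"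
    \<comment> \<open>Lengths 1 and 2 are ruled out by the absence of loops and of backtracking;
      \<open>girth\<close> only counts cycles of length at least 3.\<close>
    have "j \<noteq> Suc i" using step[of i] eq nbrs_irrefl less.prems by auto
    moreover have "j \<noteq> Suc (Suc i)" using path eq less.prems by (auto simp: nb_path_def)
    ultimately have len_p: "length p \<ge> 3" using less.prems by (simp add: p_def)
    have cas: "pcas (ws ! i) (map (\<lambda>l. (ws ! l, ws ! Suc l)) [i..<l]) (ws ! l)" if "i \<le> l" for i l
      using that by (induction "l - i" arbitrary: i) (auto simp: upt_conv_Cons)
    have "awalk (ws ! i) p (ws ! i)"
      unfolding awalk_def using cas[of i j] eq less.prems len path step
      by (auto simp: p_def nbrs_def nb_path_def)
    moreover have "distinct (tl (pawalk_verts (ws ! i) p))"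
    proof -
      have "pawalk_verts (ws ! i) p = ws ! i # map (\<lambda>l. ws ! Suc l) [i..<j]"
        using awalk_verts_conv'[of "ws ! i" p "ws ! j"] cas[of i j] less.prems
        by (simp add: p_def hd_map comp_def)
      moreover have "inj_on (\<lambda>l. ws ! Suc l) {i..<j}"
      proof (rule linorder_inj_onI')
        fix l l' assume "l \<in> {i..<j}" "l' \<in> {i..<j}" "l < l'"
        then show "ws ! Suc l \<noteq> ws ! Suc l'"
          using less.prems by (intro less.hyps) auto
      qed
      ultimately show ?thesis by (simp add: distinct_map)
    qed
    ultimately have "cycle p" using len_p unfolding cycle_def by auto
    then have "girth G \<le> enat (length p)"
      unfolding girth_def using len_p by (intro INF_lower) auto
    with girth have "K \<le> length p" by (metis enat_ord_simps(1) order_trans)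
    then show False using less.prems by (simp add: p_def)
  qed
qed

end

section \<open>Deviation of the visit counts from the binomial law\<close>

definition visits :: "nat \<Rightarrow> 'a list \<Rightarrow> 'a \<Rightarrow> nat" where
  "visits s ws v = card {i \<in> {1..s}. ws ! i = v}"

lemma visits_Suc: "visits (Suc s) ws v = visits s ws v + of_bool (ws ! Suc s = v)"
proof -
  have "{i \<in> {1..Suc s}. ws ! i = v} = {i \<in> {1..s}. ws ! i = v} \<union> (if ws ! Suc s = v then {Suc s} else {})"
    by (auto simp: le_Suc_eq)
  then show ?thesis by (auto simp: visits_def)
qed

lemma visits_take: "s < k \<Longrightarrow> visits s (take k ws) v = visits s ws v"
  by (auto simp: visits_def intro!: arg_cong[of _ _ card])

lemma visits_eq_if_not_visited:
  assumes "a \<le> s" "\<And>l. a < l \<Longrightarrow> l \<le> s \<Longrightarrow> ws ! l \<noteq> v"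
  shows "visits s ws v = visits a ws v"
  using assms unfolding visits_def by (intro arg_cong[of _ _ card]) (force simp: not_le[symmetric])

text \<open>The reference model: the law of the number of visits to a fixed vertex if the
  \<open>s\<close> positions were independent and uniform.\<close>

definition binom_prob :: "nat \<Rightarrow> nat \<Rightarrow> nat \<Rightarrow> real" where
  "binom_prob n s t = pmf (binomial_pmf s (1 / n)) t"

text \<open>The index \<open>t - 1\<close> with value 0 below the range, so that recurrences in
  \<open>t\<close> hold at \<open>t = 0\<close> without a separate case.\<close>

definition shift :: "(nat \<Rightarrow> real) \<Rightarrow> nat \<Rightarrow> real" where
  "shift f t = (case t of 0 \<Rightarrow> 0 | Suc t' \<Rightarrow> f t')"

lemma binom_prob_bounds: "0 \<le> binom_prob n s t" "binom_prob n s t \<le> 1"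
  by (simp_all add: binom_prob_def pmf_le_1)

lemma binom_prob_0: "n > 0 \<Longrightarrow> binom_prob n 0 t = of_bool (t = 0)"
  by (cases t) (auto simp: binom_prob_def)

text \<open>Conditioning on the last trial. The binomial law is used rather than its Poisson limit
  because it satisfies this recurrence without error term.\<close>

lemma binom_prob_Suc:
  assumes "n > 0"
  shows "binom_prob n (Suc s) t = binom_prob n s t + (shift (binom_prob n s) t - binom_prob n s t) / n"
proof -
  define p where "p = 1 / real n"
  have p: "0 \<le> p" "p \<le> 1" using assms by (auto simp: p_def)
  have "pmf (binomial_pmf (Suc s) p) t
    = pmf (binomial_pmf s p) t + (shift (pmf (binomial_pmf s p)) t - pmf (binomial_pmf s p) t) * p"
  proof (cases t)
    case 0
    then show ?thesis using p by (simp add: shift_def algebra_simps)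
  next
    case (Suc t')
    \<comment> \<open>The exponent of \<open>1 - p\<close> involves a truncated subtraction, so the
      boundary cases are treated apart.\<close>
    consider "t' < s" | "t' = s" | "t' > s" by linarith
    then show ?thesis
    proof cases
      case 1
      then obtain r where "s = Suc (t' + r)" by (metis less_iff_Suc_add)
      then show ?thesis using p Suc by (simp add: shift_def algebra_simps)
    qed (use p Suc in \<open>simp_all add: shift_def binomial_eq_0\<close>)
  qed
  then show ?thesis by (simp add: binom_prob_def p_def shift_def split: nat.split)
qed

section \<open>Pathwise estimates for the visit counts\<close>

context regular_graph
begin

lemma num_visited_eq_sum:
  "real (num_visited G s t ws) = (\<Sum>v\<in>V. of_bool (visits s ws v = t))"
  unfolding num_visited_def visits_def[symmetric]
  by (simp add: pair_finite_verts sum.If_cases of_bool_def Int_def)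

text \<open>The change in the number of vertices with exactly \<open>t\<close> visits when the next
  visit is to \<open>v\<close>.\<close>

definition jump :: "nat \<Rightarrow> nat \<Rightarrow> 'a list \<Rightarrow> 'a \<Rightarrow> real" where
  "jump s t ws v = of_bool (Suc (visits s ws v) = t) - of_bool (visits s ws v = t)"

text \<open>The increment of the binomial probability in one step, scaled by
  \<open>card V\<close>.\<close>

definition drift :: "nat \<Rightarrow> nat \<Rightarrow> real" where
  "drift s t = shift (binom_prob (card V) s) t - binom_prob (card V) s t"

text \<open>This is \<open>D\<^sub>t(s)\<close> of the overview.\<close>

definition dev :: "nat \<Rightarrow> nat \<Rightarrow> 'a list \<Rightarrow> real" where
  "dev s t ws = num_visited G s t ws / card V - binom_prob (card V) s t"

lemma num_visited_Suc:
  assumes "ws ! Suc s \<in> V"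
  shows "real (num_visited G (Suc s) t ws) = num_visited G s t ws + jump s t ws (ws ! Suc s)"
proof -
  have "real (num_visited G (Suc s) t ws)
    = (\<Sum>v\<in>V. of_bool (visits s ws v = t) + (if v = ws ! Suc s then jump s t ws v else 0))"
    unfolding num_visited_eq_sum by (intro sum.cong) (auto simp: visits_Suc jump_def)
  then show ?thesis
    using assms by (simp add: num_visited_eq_sum sum.distrib pair_finite_verts)
qed

lemma sum_jump: "(\<Sum>v\<in>V. jump s t ws v) = shift (\<lambda>t. num_visited G s t ws) t - num_visited G s t ws"
  by (cases t) (simp_all add: jump_def num_visited_eq_sum sum_subtractf shift_def sum_negf)

lemma dev_Suc:
  assumes "ws ! Suc s \<in> V"
  shows "dev (Suc s) t ws = dev s t ws + (jump s t ws (ws ! Suc s) - drift s t) / card V"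
  unfolding dev_def num_visited_Suc[OF assms] binom_prob_Suc[OF card_verts_pos] drift_def
  by (simp add: add_divide_distrib diff_divide_distrib)

lemma abs_jump_minus_drift_le: "\<bar>jump s t ws v - drift s t\<bar> \<le> 2"
proof -
  have "0 \<le> shift (binom_prob (card V) s) t" "shift (binom_prob (card V) s) t \<le> 1"
    by (auto simp: shift_def binom_prob_bounds split: nat.split)
  then have "\<bar>drift s t\<bar> \<le> 1"
    using binom_prob_bounds[of "card V" s t] by (simp add: drift_def)
  moreover have "\<bar>jump s t ws v\<bar> \<le> 1" by (simp add: jump_def)
  ultimately show ?thesis by linarith
qed

lemma abs_dev_le: "\<bar>dev s t ws\<bar> \<le> 1"
proof -
  have "num_visited G s t ws \<le> card V"
    unfolding num_visited_def by (intro card_mono) (auto simp: pair_finite_verts)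
  then have "0 \<le> num_visited G s t ws / real (card V)" "num_visited G s t ws / real (card V) \<le> 1"
    using card_verts_pos by auto
  then show ?thesis using binom_prob_bounds[of "card V" s t] unfolding dev_def by linarith
qed

lemma dev_0: "dev 0 t ws = 0"
  using card_verts_pos
  by (auto simp: dev_def num_visited_eq_sum visits_def binom_prob_0 of_bool_def)

lemma num_visited_take: "s < k \<Longrightarrow> num_visited G s t (take k ws) = num_visited G s t ws"
  unfolding num_visited_def visits_def[symmetric] by (simp add: visits_take)

lemma dev_take: "s < k \<Longrightarrow> dev s t (take k ws) = dev s t ws"
  by (simp add: dev_def num_visited_take)

lemma dev_lipschitz:
  assumes path: "nb_path G k ws" and "a \<le> s" "s \<le> k"
  shows "\<bar>dev s t ws - dev a t ws\<bar> \<le> 2 * real (s - a) / card V"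
  using assms(2,3)
proof (induction rule: dec_induct)
  case (step s)
  have "ws ! Suc s \<in> V" using path step nth_mem[of "Suc s" ws] by (auto simp: nb_path_def)
  then have "\<bar>dev (Suc s) t ws - dev s t ws\<bar> \<le> 2 / card V"
    using abs_jump_minus_drift_le[of s t ws "ws ! Suc s"]
    by (simp add: dev_Suc divide_right_mono)
  moreover have "2 * real (Suc s - a) / card V = 2 * real (s - a) / card V + 2 / card V"
    using step by (simp add: Suc_diff_le add_divide_distrib)
  ultimately show ?case using step by linarith
qed simp

lemma binom_prob_lipschitz:
  assumes "a \<le> s"
  shows "\<bar>binom_prob (card V) s t - binom_prob (card V) a t\<bar> \<le> real (s - a) / card V"
  using assms
proof (induction rule: dec_induct)
  case (step s)
  have "0 \<le> shift (binom_prob (card V) s) t" "shift (binom_prob (card V) s) t \<le> 1"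
    by (auto simp: shift_def binom_prob_bounds split: nat.split)
  then have "\<bar>shift (binom_prob (card V) s) t - binom_prob (card V) s t\<bar> \<le> 1"
    using binom_prob_bounds[of "card V" s t] by linarith
  then have "\<bar>binom_prob (card V) (Suc s) t - binom_prob (card V) s t\<bar> \<le> 1 / card V"
    by (simp add: binom_prob_Suc[OF card_verts_pos] divide_right_mono)
  moreover have "real (Suc s - a) / card V = real (s - a) / card V + 1 / card V"
    using step by (simp add: Suc_diff_le add_divide_distrib)
  ultimately show ?case using step by linarith
qed simp

lemma drift_lipschitz:
  assumes "a \<le> s"
  shows "\<bar>drift s t - drift a t\<bar> \<le> 2 * real (s - a) / card V"
proof -
  have "\<bar>shift (binom_prob (card V) s) t - shift (binom_prob (card V) a) t\<bar> \<le> real (s - a) / card V"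
    using binom_prob_lipschitz[OF assms] by (auto simp: shift_def split: nat.split)
  then show ?thesis
    using binom_prob_lipschitz[OF assms, of t] unfolding drift_def by simp
qed

text \<open>Expanding the square leaves a cross term at time \<open>s\<close>, which is replaced by
  its value at the earlier time \<open>a\<close>, so that \<open>L + 1\<close> steps of mixing
  separate the past from \<open>w\<close>. The delay costs \<open>4 * L / n\<close> through
  \<open>dev\<close> and \<open>2 * L / n\<close> through \<open>drift\<close>; \<open>jump\<close>
  changes only if \<open>w\<close> was visited in between, and then by at most 2.\<close>

lemma dev_Suc_square_le:
  fixes a L s :: nat
  assumes path: "nb_path G (Suc s) ws" and s: "s = a + L"
  defines "w \<equiv> ws ! Suc s" and "n \<equiv> real (card V)"
  shows "(dev (Suc s) t ws)\<^sup>2 \<le> (dev s t ws)\<^sup>2 + 2 / n * (dev a t ws * (jump a t ws w - drift a t))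
    + 2 / n * (6 * L / n + 2 * of_bool (\<exists>l\<in>{a<..s}. ws ! l = w)) + 4 / n\<^sup>2"
proof -
  have n: "n > 0" using card_verts_pos by (simp add: n_def)
  have w: "w \<in> V" using path nth_mem[of "Suc s" ws] by (auto simp: nb_path_def w_def)
  define X where "X = jump s t ws w - drift s t"
  define Y where "Y = jump a t ws w - drift a t"
  define r :: real where "r = of_bool (\<exists>l\<in>{a<..s}. ws ! l = w)"
  have X: "\<bar>X\<bar> \<le> 2" unfolding X_def by (rule abs_jump_minus_drift_le)
  have "\<bar>jump s t ws w - jump a t ws w\<bar> \<le> 2 * r"
  proof (cases "\<exists>l\<in>{a<..s}. ws ! l = w")
    case False
    then have "visits s ws w = visits a ws w"
      using s by (intro visits_eq_if_not_visited) auto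
    then show ?thesis by (simp add: jump_def r_def)
  qed (simp add: jump_def r_def)
  then have XY: "\<bar>X - Y\<bar> \<le> 2 * r + 2 * L / n"
    using drift_lipschitz[of a s t] unfolding X_def Y_def n_def s by simp
  have "dev s t ws * X = dev a t ws * Y + (dev s t ws - dev a t ws) * X + dev a t ws * (X - Y)"
    by (simp add: algebra_simps)
  also have "\<dots> \<le> dev a t ws * Y + 2 * L / n * 2 + 1 * (2 * r + 2 * L / n)"
  proof -
    have "\<bar>(dev s t ws - dev a t ws) * X\<bar> \<le> 2 * L / n * 2"
      unfolding abs_mult using X dev_lipschitz[OF path, of a s t] n
      by (intro mult_mono) (auto simp: s n_def)
    moreover have "\<bar>dev a t ws * (X - Y)\<bar> \<le> 1 * (2 * r + 2 * L / n)"
      unfolding abs_mult using XY abs_dev_le by (intro mult_mono) auto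
    ultimately show ?thesis by linarith
  qed
  finally have "dev s t ws * X \<le> dev a t ws * Y + (6 * L / n + 2 * r)"
    by simp
  then have cross: "2 / n * (dev s t ws * X) \<le> 2 / n * (dev a t ws * Y + (6 * L / n + 2 * r))"
    using n by (intro mult_left_mono) auto
  have "X\<^sup>2 \<le> 4" using abs_le_square_iff[of X 2] X by simp
  then have "(X / n)\<^sup>2 \<le> 4 / n\<^sup>2" by (simp add: power_divide divide_right_mono)
  moreover have "(dev (Suc s) t ws)\<^sup>2 = (dev s t ws)\<^sup>2 + 2 / n * (dev s t ws * X) + (X / n)\<^sup>2"
    using dev_Suc[of ws s t] w by (simp add: w_def X_def n_def power2_sum)
  ultimately show ?thesis
    using cross by (simp add: Y_def r_def distrib_left)
qed

end

text \<open>The error of one step of the second-moment recursion, scaled by \<open>n\<close>. The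
  coefficient 16 is 12 from the delay plus 4 from the uniform part of recent returns. The other
  terms come from returns at lags at least \<open>K\<close>, from imperfect mixing over
  \<open>L + 1\<close> steps, and from the squared increment.\<close>

definition step_error :: "real \<Rightarrow> real \<Rightarrow> nat \<Rightarrow> nat \<Rightarrow> nat \<Rightarrow> real" where
  "step_error C \<theta> n L K = 16 * L / n + 4 * C * \<theta> ^ K / (1 - \<theta>) + 4 * C * \<theta> ^ Suc L * sqrt n + 4 / n"

section \<open>The second moment of the deviation along the walk\<close>

context regular_graph
begin

context
  fixes u C \<theta>
  assumes u: "u \<in> V" and mixing: "mixing C \<theta>" and C: "C \<ge> 0" and \<theta>: "0 < \<theta>" "\<theta> < 1"
begin

abbreviation "ex k \<equiv> measure_pmf.expectation (nb_walk G u k)"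

lemma walk_arc:
  assumes "ws \<in> set_pmf (nb_walk G u a)" "a \<ge> 1"
  shows "ws ! a \<in> N (ws ! (a - 1))" "ws ! a \<in> V"
  using nb_path_walk[OF u assms(1)] assms(2) nth_mem[of a ws]
  by (cases a; force simp: nb_path_def)+

text \<open>Mixing is applied, from time \<open>j\<close> on, to the indicator of the vertex
  occupied at time \<open>j\<close>; its norm is 1.\<close>

lemma return_prob_le:
  assumes "j \<ge> 1"
  shows "ex (j + m) (\<lambda>ws. of_bool (ws ! (j + m) = ws ! j)) \<le> 1 / card V + C * \<theta> ^ m"
proof -
  have "ex (j + m) (\<lambda>ws. of_bool (ws ! (j + m) = ws ! j))
    = ex j (\<lambda>ws. (nbop ^^ m) (\<lambda>x y. of_bool (y = ws ! j)) (ws ! (j - 1)) (ws ! j))"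
    using expec_markov[OF u assms, of m "\<lambda>ws x y. of_bool (y = ws ! j)"] by simp
  also have "\<dots> \<le> ex j (\<lambda>_. 1 / card V + C * \<theta> ^ m)"
  proof (rule expectation_pmf_mono)
    fix ws assume ws: "ws \<in> set_pmf (nb_walk G u j)"
    define f :: "'a \<Rightarrow> real" where "f y = of_bool (y = ws ! j)" for y
    have "(\<Sum>v\<in>V. f v) = 1" "ip f f = 1"
      using walk_arc[OF ws assms] by (simp_all add: f_def ip_def pair_finite_verts of_bool_def if_distrib cong: if_cong)
    moreover have "\<bar>(nbop ^^ m) (\<lambda>_. f) (ws ! (j - 1)) (ws ! j) - (\<Sum>v\<in>V. f v) / card V\<bar>
      \<le> C * \<theta> ^ m * sqrt (ip f f)"
      using mixing walk_arc[OF ws assms] unfolding mixing_def by blast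
    ultimately have "(nbop ^^ m) (\<lambda>_. f) (ws ! (j - 1)) (ws ! j) \<le> 1 / card V + C * \<theta> ^ m"
      by simp
    then show "(nbop ^^ m) (\<lambda>x y. of_bool (y = ws ! j)) (ws ! (j - 1)) (ws ! j) \<le> 1 / card V + C * \<theta> ^ m"
      unfolding f_def[abs_def] .
  qed (simp add: u)
  finally show ?thesis by simp
qed

text \<open>A union bound over the lags from 1 to \<open>L\<close>. Lags below \<open>K\<close> are
  impossible by the girth, and the mixing errors of the others add up to a geometric tail.\<close>

lemma recent_return_prob_le:
  fixes a L s :: nat
  assumes a: "a \<ge> 1" and girth: "enat K \<le> girth G" and s: "s = a + L"
  shows "ex (Suc s) (\<lambda>ws. of_bool (\<exists>l\<in>{a<..s}. ws ! l = ws ! Suc s)) \<le> L / card V + C * \<theta> ^ K / (1 - \<theta>)"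
proof -
  define h where "h m = (if m < K then 0 else \<theta> ^ m)" for m
  have single: "ex (Suc s) (\<lambda>ws. of_bool (ws ! l = ws ! Suc s)) \<le> 1 / card V + C * h (Suc s - l)"
    if l: "l \<in> {a<..s}" for l
  proof (cases "Suc s - l < K")
    case True
    have "ex (Suc s) (\<lambda>ws. of_bool (ws ! l = ws ! Suc s)) = ex (Suc s) (\<lambda>_. 0 :: real)"
    proof (rule expectation_pmf_cong)
      fix ws assume "ws \<in> set_pmf (nb_walk G u (Suc s))"
      from nb_path_no_short_return[OF nb_path_walk[OF u this] girth, of l "Suc s"]
      show "of_bool (ws ! l = ws ! Suc s) = (0 :: real)" using l True by simp
    qed
    then show ?thesis using True by (simp add: h_def)
  next
    case False
    have "ex (Suc s) (\<lambda>ws. of_bool (ws ! l = ws ! Suc s)) = ex (Suc s) (\<lambda>ws. of_bool (ws ! Suc s = ws ! l) :: real)"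
      by (rule expectation_pmf_cong) auto
    then show ?thesis
      using False return_prob_le[of l "Suc s - l"] l a by (simp add: h_def)
  qed
  have h_sum: "(\<Sum>l\<in>{a<..s}. h (Suc s - l)) \<le> \<theta> ^ K / (1 - \<theta>)"
  proof -
    have "(\<Sum>l\<in>{a<..s}. h (Suc s - l)) = (\<Sum>m\<in>{1..L}. h m)"
      using s by (intro sum.reindex_bij_witness[of _ "\<lambda>m. Suc s - m" "\<lambda>l. Suc s - l"]) auto
    also have "\<dots> = (\<Sum>m\<in>{1..L} \<inter> {K..}. \<theta> ^ m)"
      unfolding h_def by (intro sum.mono_neutral_cong_right) auto
    also have "\<dots> \<le> (\<Sum>m\<in>{K..<K + Suc L}. \<theta> ^ m)"
      using \<theta> by (intro sum_mono2) auto
    also have "\<dots> = \<theta> ^ K * (\<Sum>i<Suc L. \<theta> ^ i)"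
      unfolding sum_distrib_left
      by (rule sum.reindex_bij_witness[of _ "\<lambda>i. K + i" "\<lambda>m. m - K"]) (auto simp: power_add[symmetric])
    also have "(\<Sum>i<Suc L. \<theta> ^ i) \<le> 1 / (1 - \<theta>)"
      using \<theta> by (subst sum_gp_strict) (auto intro!: divide_right_mono)
    finally show ?thesis using \<theta> by simp
  qed
  have "ex (Suc s) (\<lambda>ws. of_bool (\<exists>l\<in>{a<..s}. ws ! l = ws ! Suc s))
    \<le> ex (Suc s) (\<lambda>ws. \<Sum>l\<in>{a<..s}. of_bool (ws ! l = ws ! Suc s) :: real)"
  proof (rule expectation_pmf_mono)
    fix ws
    show "of_bool (\<exists>l\<in>{a<..s}. ws ! l = ws ! Suc s) \<le> (\<Sum>l\<in>{a<..s}. of_bool (ws ! l = ws ! Suc s) :: real)"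
    proof (cases "\<exists>l\<in>{a<..s}. ws ! l = ws ! Suc s")
      case True
      then obtain l where "l \<in> {a<..s}" "ws ! l = ws ! Suc s" by blast
      then show ?thesis
        using member_le_sum[of l "{a<..s}" "\<lambda>l. of_bool (ws ! l = ws ! Suc s) :: real"] True by simp
    qed (simp add: sum_nonneg)
  qed (simp add: u)
  also have "\<dots> = (\<Sum>l\<in>{a<..s}. ex (Suc s) (\<lambda>ws. of_bool (ws ! l = ws ! Suc s)))"
    by (rule Bochner_Integration.integral_sum) (simp add: u)
  also have "\<dots> \<le> (\<Sum>l\<in>{a<..s}. 1 / card V + C * h (Suc s - l))"
    by (rule sum_mono) (rule single)
  also have "\<dots> = L / card V + C * (\<Sum>l\<in>{a<..s}. h (Suc s - l))"
    by (simp add: sum.distrib sum_distrib_left s)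
  also have "\<dots> \<le> L / card V + C * (\<theta> ^ K / (1 - \<theta>))"
    using C h_sum by (intro add_left_mono mult_left_mono) auto
  finally show ?thesis by simp
qed

text \<open>For a uniform next vertex the scaled mean increment of the deviation is
  \<open>D\<^sub>t\<^sub>-\<^sub>1 - D\<^sub>t\<close>: proportions and binomial probabilities
  follow the same linear recurrence, so their difference does too.\<close>

lemma sum_jump_minus_drift:
  "(\<Sum>v\<in>V. jump a t ws v - drift a t) / card V = shift (\<lambda>t. dev a t ws) t - dev a t ws"
  using verts_nonempty
  by (cases t) (simp_all add: pair_finite_verts sum_subtractf sum_jump drift_def dev_def shift_def diff_divide_distrib)

text \<open>Conditionally on the first \<open>a\<close> steps the vertex at time
  \<open>a + m\<close> is nearly uniform, and \<open>dev a t\<close> is already determined. The test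
  function is bounded by 2, hence has norm at most \<open>2 * sqrt (card V)\<close>.\<close>

lemma expec_dev_jump_le:
  assumes a: "a \<ge> 1"
  shows "ex (a + m) (\<lambda>ws. dev a t ws * (jump a t ws (ws ! (a + m)) - drift a t))
    \<le> ex a (\<lambda>ws. (shift (\<lambda>t. dev a t ws) t)\<^sup>2) / 2 + 2 * C * \<theta> ^ m * sqrt (card V)"
proof -
  define f where "f ws v = dev a t ws * (jump a t ws v - drift a t)" for ws v
  have f_take: "f (take (Suc a) ws) = f ws" for ws
    by (simp add: f_def fun_eq_iff dev_take jump_def visits_take)
  have "ex (a + m) (\<lambda>ws. dev a t ws * (jump a t ws (ws ! (a + m)) - drift a t))
    = ex (a + m) (\<lambda>ws. f (take (Suc a) ws) (ws ! (a + m)))"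
    unfolding f_take unfolding f_def ..
  also have "\<dots> = ex a (\<lambda>ws. (nbop ^^ m) (\<lambda>_. f ws) (ws ! (a - 1)) (ws ! a))"
    using expec_markov[OF u a, of m "\<lambda>ws _. f ws"] by simp
  also have "\<dots> \<le> ex a (\<lambda>ws. (shift (\<lambda>t. dev a t ws) t)\<^sup>2 / 2 + 2 * C * \<theta> ^ m * sqrt (card V))"
  proof (rule expectation_pmf_mono)
    fix ws assume ws: "ws \<in> set_pmf (nb_walk G u a)"
    have "f ws v * f ws v \<le> 2\<^sup>2" for v
    proof -
      have "\<bar>f ws v\<bar> \<le> 1 * 2"
        unfolding f_def abs_mult using abs_dev_le abs_jump_minus_drift_le by (intro mult_mono) auto
      then show ?thesis using abs_le_square_iff[of "f ws v" 2] by (simp add: power2_eq_square)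
    qed
    then have "ip (f ws) (f ws) \<le> (\<Sum>v\<in>V. 2\<^sup>2)" unfolding ip_def by (rule sum_mono)
    then have "sqrt (ip (f ws) (f ws)) \<le> sqrt (2\<^sup>2 * card V)" by (simp add: mult.commute)
    also have "\<dots> = 2 * sqrt (card V)" by (simp add: real_sqrt_mult)
    finally have "C * \<theta> ^ m * sqrt (ip (f ws) (f ws)) \<le> C * \<theta> ^ m * (2 * sqrt (card V))"
      using C \<theta> by (intro mult_left_mono) auto
    moreover have "\<bar>(nbop ^^ m) (\<lambda>_. f ws) (ws ! (a - 1)) (ws ! a) - (\<Sum>v\<in>V. f ws v) / card V\<bar>
      \<le> C * \<theta> ^ m * sqrt (ip (f ws) (f ws))"
      using mixing walk_arc[OF ws a] unfolding mixing_def by blast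
    moreover have "(\<Sum>v\<in>V. f ws v) / card V = dev a t ws * (shift (\<lambda>t. dev a t ws) t - dev a t ws)"
      unfolding sum_jump_minus_drift[symmetric] by (simp add: f_def sum_distrib_left)
    \<comment> \<open>The term \<open>- x\<^sup>2\<close> has the favourable sign and absorbs the
      dependence on \<open>D\<^sub>t\<close>. Only \<open>D\<^sub>t\<^sub>-\<^sub>1\<close> is left,
      so induction on \<open>t\<close> works without a Gronwall argument.\<close>
    moreover have amgm: "x * (y - x) \<le> y\<^sup>2 / 2" for x y :: real
    proof -
      have "0 \<le> (y - x)\<^sup>2 + x\<^sup>2" by simp
      then show ?thesis by (simp add: power2_eq_square algebra_simps)
    qed
    moreover from amgm[of "dev a t ws" "shift (\<lambda>t. dev a t ws) t"]
    have "dev a t ws * (shift (\<lambda>t. dev a t ws) t - dev a t ws) \<le> (shift (\<lambda>t. dev a t ws) t)\<^sup>2 / 2" .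
    ultimately show "(nbop ^^ m) (\<lambda>_. f ws) (ws ! (a - 1)) (ws ! a)
      \<le> (shift (\<lambda>t. dev a t ws) t)\<^sup>2 / 2 + 2 * C * \<theta> ^ m * sqrt (card V)"
      by (simp add: mult_ac)
  qed (simp add: u)
  also have "\<dots> = ex a (\<lambda>ws. (shift (\<lambda>t. dev a t ws) t)\<^sup>2) / 2 + 2 * C * \<theta> ^ m * sqrt (card V)"
    by (simp add: u)
  finally show ?thesis .
qed

lemma expec_dev_square_Suc:
  assumes a: "a \<ge> 1" and girth: "enat K \<le> girth G" and s: "s = a + L"
  shows "ex (Suc s) (\<lambda>ws. (dev (Suc s) t ws)\<^sup>2) \<le> ex s (\<lambda>ws. (dev s t ws)\<^sup>2)
    + (ex a (\<lambda>ws. (shift (\<lambda>t. dev a t ws) t)\<^sup>2) + step_error C \<theta> (card V) L K) / card V"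
proof -
  define n where "n = real (card V)"
  have n: "n > 0" using card_verts_pos by (simp add: n_def)
  define R :: "'a list \<Rightarrow> real" where "R ws = of_bool (\<exists>l\<in>{a<..s}. ws ! l = ws ! Suc s)" for ws
  define J where "J ws = dev a t ws * (jump a t ws (ws ! Suc s) - drift a t)" for ws
  have R: "ex (Suc s) R \<le> L / n + C * \<theta> ^ K / (1 - \<theta>)"
    unfolding n_def R_def using a girth s by (rule recent_return_prob_le)
  have J: "ex (Suc s) J \<le> ex a (\<lambda>ws. (shift (\<lambda>t. dev a t ws) t)\<^sup>2) / 2 + 2 * C * \<theta> ^ Suc L * sqrt n"
    using expec_dev_jump_le[OF a, of "Suc L" t] by (simp add: J_def[abs_def] s n_def)
  have "ex (Suc s) (\<lambda>ws. (dev (Suc s) t ws)\<^sup>2)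
    \<le> ex (Suc s) (\<lambda>ws. (dev s t ws)\<^sup>2 + 2 / n * J ws + 2 / n * (6 * L / n + 2 * R ws) + 4 / n\<^sup>2)"
  proof (rule expectation_pmf_mono)
    fix ws assume "ws \<in> set_pmf (nb_walk G u (Suc s))"
    from dev_Suc_square_le[OF nb_path_walk[OF u this] s, of t]
    show "(dev (Suc s) t ws)\<^sup>2 \<le> (dev s t ws)\<^sup>2 + 2 / n * J ws + 2 / n * (6 * L / n + 2 * R ws) + 4 / n\<^sup>2"
      by (simp add: n_def J_def R_def)
  qed (simp add: u)
  also have "\<dots> = ex (Suc s) (\<lambda>ws. (dev s t ws)\<^sup>2) + 2 / n * ex (Suc s) J
      + 2 / n * (6 * L / n + 2 * ex (Suc s) R) + 4 / n\<^sup>2"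
    by (simp add: u)
  also have "ex (Suc s) (\<lambda>ws. (dev s t ws)\<^sup>2) = ex s (\<lambda>ws. (dev s t ws)\<^sup>2)"
    using expec_take[OF u, of s "Suc s" "\<lambda>ws. (dev s t ws)\<^sup>2"] by (simp add: dev_take)
  also have "ex s (\<lambda>ws. (dev s t ws)\<^sup>2) + 2 / n * ex (Suc s) J + 2 / n * (6 * L / n + 2 * ex (Suc s) R) + 4 / n\<^sup>2
    \<le> ex s (\<lambda>ws. (dev s t ws)\<^sup>2)
      + 2 / n * (ex a (\<lambda>ws. (shift (\<lambda>t. dev a t ws) t)\<^sup>2) / 2 + 2 * C * \<theta> ^ Suc L * sqrt n)
      + 2 / n * (6 * L / n + 2 * (L / n + C * \<theta> ^ K / (1 - \<theta>))) + 4 / n\<^sup>2"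
    using n R J by (intro add_mono mult_left_mono order_refl) auto
  also have "\<dots> = ex s (\<lambda>ws. (dev s t ws)\<^sup>2)
      + (ex a (\<lambda>ws. (shift (\<lambda>t. dev a t ws) t)\<^sup>2) + step_error C \<theta> (card V) L K) / n"
    using n by (simp add: step_error_def n_def[symmetric] add_divide_distrib power2_eq_square distrib_left mult_ac)
  finally show ?thesis by (simp add: n_def)
qed

text \<open>Outer induction on \<open>t\<close>, inner induction on time. Up to time
  \<open>L + 1\<close> the Lipschitz bound suffices, because the square of \<open>dev\<close> is at
  most its absolute value. Every later step adds at most
  \<open>(t * \<kappa> + step_error) / n\<close>, and there are at most \<open>n\<close> steps,
  which gives \<open>\<kappa> + t * \<kappa>\<close>.\<close>

lemma expec_dev_square_le:
  assumes girth: "enat K \<le> girth G" and "s \<le> card V"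
  shows "ex s (\<lambda>ws. (dev s t ws)\<^sup>2) \<le> Suc t * (2 * Suc L / card V + step_error C \<theta> (card V) L K)"
  using \<open>s \<le> card V\<close>
proof (induction t arbitrary: s rule: less_induct)
  case (less t)
  define n where "n = real (card V)"
  have n: "n > 0" using card_verts_pos by (simp add: n_def)
  define \<kappa> where "\<kappa> = 2 * Suc L / n + step_error C \<theta> (card V) L K"
  have \<eta>: "step_error C \<theta> (card V) L K \<ge> 0"
    using C \<theta> by (auto simp: step_error_def)
  then have \<kappa>: "\<kappa> \<ge> 0" using n by (simp add: \<kappa>_def)
  have prev: "ex a (\<lambda>ws. (shift (\<lambda>t. dev a t ws) t)\<^sup>2) \<le> t * \<kappa>" if "a \<le> card V" for a
  proof (cases t)
    case (Suc t')
    then show ?thesis using less.IH[of t' a] that by (simp add: shift_def \<kappa>_def n_def)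
  qed (simp add: shift_def)
  have "ex s (\<lambda>ws. (dev s t ws)\<^sup>2) \<le> 2 * Suc L / n + s / n * (t * \<kappa> + step_error C \<theta> (card V) L K)"
    using less.prems
  proof (induction s)
    case 0
    then show ?case using n by (simp add: dev_0)
  next
    case (Suc s)
    show ?case
    proof (cases "s < Suc L")
      case True
      have "ex (Suc s) (\<lambda>ws. (dev (Suc s) t ws)\<^sup>2) \<le> ex (Suc s) (\<lambda>_. 2 * Suc L / n)"
      proof (rule expectation_pmf_mono)
        fix ws assume "ws \<in> set_pmf (nb_walk G u (Suc s))"
        then have path: "nb_path G (Suc s) ws" by (rule nb_path_walk[OF u])
        have "(dev (Suc s) t ws)\<^sup>2 = \<bar>dev (Suc s) t ws\<bar> * \<bar>dev (Suc s) t ws\<bar>"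
          by (simp add: power2_eq_square)
        also have "\<dots> \<le> 1 * (2 * Suc s / n)"
          using abs_dev_le dev_lipschitz[OF path, of 0 "Suc s" t]
          by (intro mult_mono) (auto simp: dev_0 n_def)
        also have "\<dots> \<le> 2 * Suc L / n" using True n by (simp add: divide_right_mono)
        finally show "(dev (Suc s) t ws)\<^sup>2 \<le> 2 * Suc L / n" .
      qed (simp add: u)
      moreover have "0 \<le> Suc s / n * (t * \<kappa> + step_error C \<theta> (card V) L K)" using n \<kappa> \<eta> by simp
      ultimately show ?thesis by simp
    next
      case False
      define a where "a = s - L"
      have a: "a \<ge> 1" "s = a + L" "a \<le> card V" using False Suc.prems by (auto simp: a_def)
      have "ex (Suc s) (\<lambda>ws. (dev (Suc s) t ws)\<^sup>2) \<le> ex s (\<lambda>ws. (dev s t ws)\<^sup>2)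
        + (ex a (\<lambda>ws. (shift (\<lambda>t. dev a t ws) t)\<^sup>2) + step_error C \<theta> (card V) L K) / n"
        unfolding n_def using a(1) girth a(2) by (rule expec_dev_square_Suc)
      also have "\<dots> \<le> (2 * Suc L / n + s / n * (t * \<kappa> + step_error C \<theta> (card V) L K)) + (t * \<kappa> + step_error C \<theta> (card V) L K) / n"
        using Suc prev[OF a(3)] n by (intro add_mono divide_right_mono) auto
      also have "\<dots> = 2 * Suc L / n + Suc s / n * (t * \<kappa> + step_error C \<theta> (card V) L K)"
        by (simp add: add_divide_distrib algebra_simps)
      finally show ?thesis .
    qed
  qed
  also have "\<dots> \<le> 2 * Suc L / n + 1 * (t * \<kappa> + step_error C \<theta> (card V) L K)"
    using less.prems n \<kappa> \<eta> by (intro add_left_mono mult_right_mono) (auto simp: n_def)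
  also have "\<dots> = \<kappa> + t * \<kappa>" by (simp add: \<kappa>_def)
  also have "\<dots> = Suc t * \<kappa>" by (simp add: algebra_simps)
  finally show ?case by (simp add: \<kappa>_def n_def)
qed

text \<open>Chebyshev's inequality, obtained from the pointwise bound of the indicator below by
  \<open>1 - dev\<^sup>2 / \<delta>\<^sup>2\<close>.\<close>

lemma prob_dev_le:
  assumes girth: "enat K \<le> girth G" and "\<delta> > 0"
  shows "measure_pmf.prob (nb_walk G u (card V)) {ws. \<bar>dev (card V) t ws\<bar> \<le> \<delta>}
    \<ge> 1 - Suc t * (2 * Suc L / card V + step_error C \<theta> (card V) L K) / \<delta>\<^sup>2"
proof -
  define n where "n = card V"
  have "1 - Suc t * (2 * Suc L / card V + step_error C \<theta> (card V) L K) / \<delta>\<^sup>2 \<le> 1 - ex n (\<lambda>ws. (dev n t ws)\<^sup>2) / \<delta>\<^sup>2"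
    using expec_dev_square_le[OF girth order_refl] \<open>\<delta> > 0\<close>
    by (intro diff_left_mono divide_right_mono) (auto simp: n_def)
  also have "\<dots> = ex n (\<lambda>ws. 1 - (dev n t ws)\<^sup>2 / \<delta>\<^sup>2)"
    by (simp add: u)
  also have "\<dots> \<le> ex n (indicator {ws. \<bar>dev n t ws\<bar> \<le> \<delta>})"
  proof (rule expectation_pmf_mono)
    fix ws
    have "1 \<le> (dev n t ws)\<^sup>2 / \<delta>\<^sup>2" if "\<not> \<bar>dev n t ws\<bar> \<le> \<delta>"
      using that \<open>\<delta> > 0\<close> abs_le_square_iff[of \<delta> "dev n t ws"] by simp
    then show "1 - (dev n t ws)\<^sup>2 / \<delta>\<^sup>2 \<le> indicator {ws. \<bar>dev n t ws\<bar> \<le> \<delta>} ws"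
      by (auto simp: indicator_def)
  qed (simp add: u)
  finally show ?thesis by (simp add: n_def)
qed

end
end

section \<open>The Poisson limit\<close>

text \<open>The probability splits into \<open>A n\<close>, the falling factorial over
  \<open>n ^ t\<close> and \<open>fact t\<close>, and \<open>B n\<close>, which is
  \<open>(1 - 1 / n) ^ (n - t)\<close>.\<close>

lemma binom_prob_tendsto_poisson:
  "(\<lambda>n. binom_prob n n t) \<longlonglongrightarrow> 1 / (exp 1 * fact t)"
proof -
  define A where "A n = (\<Prod>i = 0..<t. (real n - real i) / real n) / fact t" for n
  define B where "B n = (1 + (- 1) / real n) ^ n / (1 - 1 / real n) ^ t" for n
  have "(\<lambda>n. (real n - real i) / real n) \<longlonglongrightarrow> 1" for i by real_asymp
  then have "A \<longlonglongrightarrow> (\<Prod>i = 0..<t. 1) / fact t"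
    unfolding A_def by (intro tendsto_intros) auto
  moreover have "B \<longlonglongrightarrow> exp (- 1) / 1 ^ t"
    unfolding B_def
  proof (intro tendsto_intros tendsto_exp_limit_sequentially)
    show "(\<lambda>n. 1 - 1 / real n) \<longlonglongrightarrow> 1" by real_asymp
  qed auto
  ultimately have "(\<lambda>n. A n * B n) \<longlonglongrightarrow> (\<Prod>i = 0..<t. 1) / fact t * (exp (- 1) / 1 ^ t)"
    by (rule tendsto_mult)
  moreover have "eventually (\<lambda>n. A n * B n = binom_prob n n t) sequentially"
    \<comment> \<open>With \<open>n \<ge> t\<close> the exponent \<open>n - t\<close> is not
      truncated, and \<open>n \<ge> 2\<close> keeps \<open>1 - 1 / n\<close> nonzero for the
      division in \<open>B\<close>.\<close>
    using eventually_ge_at_top[of "max 2 t"]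
  proof eventually_elim
    case (elim n)
    have "real (n choose t) * (1 / real n) ^ t = A n"
    proof -
      have "real (n choose t) = (\<Prod>i = 0..<t. real n - real i) / fact t"
        by (simp add: binomial_gbinomial gbinomial_prod_rev)
      then show ?thesis by (simp add: A_def prod_dividef power_one_over)
    qed
    moreover have "(1 - 1 / real n) ^ (n - t) = B n"
      using elim by (simp add: B_def power_diff)
    ultimately show ?case
      using elim by (simp add: binom_prob_def)
  qed
  ultimately have "(\<lambda>n. binom_prob n n t) \<longlonglongrightarrow> (\<Prod>i = 0..<t. 1) / fact t * (exp (- 1) / 1 ^ t)"
    by (rule Lim_transform_eventually)
  then show ?thesis by (simp add: exp_minus field_simps)
qed

text \<open>The successor of the floor is at least \<open>sqrt n\<close>, so the power is at most
  \<open>\<theta>\<close> to the exponent \<open>sqrt n\<close>, which decays faster than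
  \<open>sqrt n\<close> grows.\<close>

lemma power_Suc_floor_sqrt_tendsto_0:
  assumes "0 < \<theta>" "\<theta> < 1"
  shows "(\<lambda>n. \<theta> ^ Suc (nat \<lfloor>sqrt (real n)\<rfloor>) * sqrt (real n)) \<longlonglongrightarrow> 0"
proof (rule tendsto_sandwich[where f = "\<lambda>_. 0" and h = "\<lambda>n. exp (ln \<theta> * sqrt (real n)) * sqrt (real n)"])
  define c where "c = - ln \<theta>"
  have c: "c > 0" using assms by (simp add: c_def)
  have "(\<lambda>n. exp (- c * sqrt (real n)) * sqrt (real n)) \<longlonglongrightarrow> 0"
    using c by real_asymp
  then show "(\<lambda>n. exp (ln \<theta> * sqrt (real n)) * sqrt (real n)) \<longlonglongrightarrow> 0"
    by (simp add: c_def)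
  show "eventually (\<lambda>n. \<theta> ^ Suc (nat \<lfloor>sqrt (real n)\<rfloor>) * sqrt (real n) \<le> exp (ln \<theta> * sqrt (real n)) * sqrt (real n)) sequentially"
  proof (intro always_eventually allI mult_right_mono)
    fix n :: nat
    have "\<theta> ^ Suc (nat \<lfloor>sqrt (real n)\<rfloor>) = \<theta> powr real (Suc (nat \<lfloor>sqrt (real n)\<rfloor>))"
      using assms by (simp only: powr_realpow)
    also have "\<dots> \<le> \<theta> powr sqrt (real n)"
    proof (rule powr_mono')
      have "of_int \<lfloor>sqrt (real n)\<rfloor> = real (nat \<lfloor>sqrt (real n)\<rfloor>)" by simp
      then show "sqrt (real n) \<le> real (Suc (nat \<lfloor>sqrt (real n)\<rfloor>))"
        unfolding of_nat_Suc by linarith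
    qed (use assms in auto)
    finally show "\<theta> ^ Suc (nat \<lfloor>sqrt (real n)\<rfloor>) \<le> exp (ln \<theta> * sqrt (real n))"
      using assms by (simp add: powr_def mult.commute)
  qed simp
  show "eventually (\<lambda>n. 0 \<le> \<theta> ^ Suc (nat \<lfloor>sqrt (real n)\<rfloor>) * sqrt (real n)) sequentially"
    using assms by simp
qed simp

lemma floor_sqrt_over_tendsto_0: "(\<lambda>n. real (nat \<lfloor>sqrt (real n)\<rfloor>) / real n) \<longlonglongrightarrow> 0"
proof (rule tendsto_sandwich[where f = "\<lambda>_. 0" and h = "\<lambda>n. sqrt (real n) / real n"])
  show "(\<lambda>n. sqrt (real n) / real n) \<longlonglongrightarrow> 0" by real_asymp
  show "eventually (\<lambda>n. real (nat \<lfloor>sqrt (real n)\<rfloor>) / real n \<le> sqrt (real n) / real n) sequentially"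
    by (intro always_eventually allI divide_right_mono) auto
  show "eventually (\<lambda>n. 0 \<le> real (nat \<lfloor>sqrt (real n)\<rfloor>) / real n) sequentially"
    by simp
qed simp

theorem theorem1p1:
  fixes d t :: nat and lam :: real and I :: "nat set"
    and G :: "nat \<Rightarrow> 'a pair_pre_digraph" and g :: "nat \<Rightarrow> real" and w0 :: "nat \<Rightarrow> 'a"
  assumes "d \<ge> 3" and "lam < real d"
    and "infinite I"
    and "\<And>n. n \<in> I \<Longrightarrow> ndl_graph n d lam (G n)"
    and "\<And>n. n \<in> I \<Longrightarrow> ereal (g n) \<le> ereal_of_enat (girth (G n))"
    and "filterlim g at_top (inf sequentially (principal I))"
    and "\<And>n. n \<in> I \<Longrightarrow> w0 n \<in> pverts (G n)"
  shows "\<exists>\<epsilon> :: nat \<Rightarrow> real.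
    (\<epsilon> \<longlongrightarrow> 0) (inf sequentially (principal I)) \<and>
    ((\<lambda>n. measure_pmf.prob (nb_walk (G n) (w0 n) n)
        {ws. \<bar>real (num_visited (G n) n t ws) / real n - 1 / (exp 1 * fact t)\<bar> \<le> \<epsilon> n})
      \<longlongrightarrow> 1) (inf sequentially (principal I))"
proof -
  define F where "F = inf sequentially (principal I)"
  have F_le: "F \<le> sequentially" by (simp add: F_def)
  \<comment> \<open>The mixing estimate divides by the gap constant; the maximum with 1 makes it
    positive and stays below \<open>d\<close>.\<close>
  have lam: "max lam 1 > 0" "max lam 1 < real d" using assms(1,2) by auto
  obtain C \<theta> where C: "C \<ge> 0" and \<theta>: "0 < \<theta>" "\<theta> < 1"
    and mix: "\<And>G :: 'a pair_pre_digraph. regular_graph G d \<Longrightarrow> regular_graph.spectral_gap G (max lam 1)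
      \<Longrightarrow> regular_graph.mixing G d C \<theta>"
    using uniform_mixing[OF assms(1) lam] by metis
  \<comment> \<open>Long enough for \<open>\<theta> ^ Suc (L n) * sqrt n\<close> to vanish, short
    enough for \<open>L n / n\<close> to vanish.\<close>
  define L where "L n = nat \<lfloor>sqrt (real n)\<rfloor>" for n
  define K where "K n = nat \<lfloor>g n\<rfloor>" for n
  define \<kappa> where "\<kappa> n = Suc t * (2 * Suc (L n) / n + step_error C \<theta> n (L n) (K n))" for n
  \<comment> \<open>The first summand is the Chebyshev threshold \<open>\<delta>\<close>: it tends
    to 0, and so does the failure bound
    \<open>\<kappa> n / \<delta>\<^sup>2 = sqrt (\<kappa> n)\<close>. The second is the
    deterministic distance from the binomial probability to its limit.\<close>
  define \<epsilon> where "\<epsilon> n = sqrt (sqrt (\<kappa> n)) + \<bar>binom_prob n n t - 1 / (exp 1 * fact t)\<bar>" for n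

  have "(\<kappa> \<longlongrightarrow> Suc t * ((2 * 0 + 2 * 0) + (16 * 0 + 4 * C * 0 / (1 - \<theta>) + 4 * C * 0 + 4 * 0))) F"
  proof -
    have inv: "((\<lambda>n. 1 / real n) \<longlongrightarrow> 0) F"
      by (rule tendsto_mono[OF F_le]) real_asymp
    have L: "((\<lambda>n. real (L n) / real n) \<longlongrightarrow> 0) F"
      unfolding L_def by (rule tendsto_mono[OF F_le floor_sqrt_over_tendsto_0])
    have LS: "((\<lambda>n. \<theta> ^ Suc (L n) * sqrt n) \<longlongrightarrow> 0) F"
      unfolding L_def by (rule tendsto_mono[OF F_le power_Suc_floor_sqrt_tendsto_0[OF \<theta>]])
    have "filterlim K sequentially F"
      unfolding K_def using assms(6) unfolding F_def
      by (intro filterlim_compose[OF filterlim_nat_sequentially] filterlim_compose[OF filterlim_floor_sequentially])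
    then have K: "((\<lambda>n. \<theta> ^ K n) \<longlongrightarrow> 0) F"
      using \<theta> by (intro filterlim_compose[OF LIMSEQ_realpow_zero]) auto
    have "\<kappa> = (\<lambda>n. Suc t * ((2 * (real (L n) / real n) + 2 * (1 / real n)) + (16 * (real (L n) / real n)
        + 4 * C * \<theta> ^ K n / (1 - \<theta>) + 4 * C * (\<theta> ^ Suc (L n) * sqrt n) + 4 * (1 / real n))))"
      by (simp add: fun_eq_iff \<kappa>_def step_error_def add_divide_distrib)
    then show ?thesis
      using \<theta> by (simp only:) (intro tendsto_intros inv L LS K; simp)
  qed
  then have \<kappa>_lim: "(\<kappa> \<longlongrightarrow> 0) F" by simp
  have "((\<lambda>n. binom_prob n n t - 1 / (exp 1 * fact t)) \<longlongrightarrow> 0) F"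
    using tendsto_mono[OF F_le binom_prob_tendsto_poisson[of t]] by (simp add: LIM_zero)
  then have "(\<epsilon> \<longlongrightarrow> sqrt (sqrt 0) + \<bar>0\<bar>) F"
    unfolding \<epsilon>_def[abs_def] by (intro tendsto_intros \<kappa>_lim)
  then have "(\<epsilon> \<longlongrightarrow> 0) F" by simp
  moreover have "((\<lambda>n. measure_pmf.prob (nb_walk (G n) (w0 n) n)
        {ws. \<bar>real (num_visited (G n) n t ws) / real n - 1 / (exp 1 * fact t)\<bar> \<le> \<epsilon> n}) \<longlongrightarrow> 1) F"
  proof (rule tendsto_sandwich[where h = "\<lambda>_. 1"])
    have "((\<lambda>n. 1 - sqrt (\<kappa> n)) \<longlongrightarrow> 1 - sqrt 0) F"
      by (intro tendsto_intros \<kappa>_lim)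
    then show "((\<lambda>n. 1 - sqrt (\<kappa> n)) \<longlongrightarrow> 1) F" by simp
    show "eventually (\<lambda>n. 1 - sqrt (\<kappa> n) \<le> measure_pmf.prob (nb_walk (G n) (w0 n) n)
        {ws. \<bar>real (num_visited (G n) n t ws) / real n - 1 / (exp 1 * fact t)\<bar> \<le> \<epsilon> n}) F"
      unfolding F_def eventually_inf_principal
      \<comment> \<open>For \<open>n \<ge> 2\<close> the index range \<open>{1..<n}\<close> defining
        \<open>lam\<close> is nonempty, as the spectral gap lemma requires.\<close>
      using eventually_ge_at_top[of 2]
    proof (eventually_elim, intro impI)
      fix n :: nat assume n: "2 \<le> n" and "n \<in> I"
      have ndl: "ndl_graph n d lam (G n)" by (rule assms(4)) fact
      then have card: "card (pverts (G n)) = n" by (simp add: ndl_graph_def)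
      interpret regular_graph "G n" d
        using ndl_graph_regular[OF ndl assms(1)] n by simp
      have mixing: "mixing C \<theta>"
        using mix regular_graph_axioms ndl_graph_spectral_gap[OF ndl n] by blast
      have girth: "enat (K n) \<le> girth (G n)"
      proof (cases "girth (G n)")
        case (enat m)
        then have "g n \<le> real m" using assms(5)[OF \<open>n \<in> I\<close>] by simp
        then have "K n \<le> m" unfolding K_def by linarith
        then show ?thesis using enat by simp
      qed simp
      have "\<kappa> n > 0"
        using n C \<theta> unfolding \<kappa>_def step_error_def
        by (intro mult_pos_pos add_pos_nonneg add_nonneg_nonneg) auto
      define \<delta> where "\<delta> = sqrt (sqrt (\<kappa> n))"
      have \<delta>: "\<delta> > 0" "\<delta>\<^sup>2 = sqrt (\<kappa> n)" using \<open>\<kappa> n > 0\<close> by (auto simp: \<delta>_def)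
      have "1 - sqrt (\<kappa> n) = 1 - \<kappa> n / \<delta>\<^sup>2"
        using \<open>\<kappa> n > 0\<close> by (simp add: \<delta> real_div_sqrt)
      also have "\<dots> \<le> measure_pmf.prob (nb_walk (G n) (w0 n) n) {ws. \<bar>dev n t ws\<bar> \<le> \<delta>}"
        using prob_dev_le[OF assms(7)[OF \<open>n \<in> I\<close>] mixing C \<theta> girth \<delta>(1), of t "L n"]
        by (simp add: card \<kappa>_def)
      also have "\<dots> \<le> measure_pmf.prob (nb_walk (G n) (w0 n) n)
        {ws. \<bar>real (num_visited (G n) n t ws) / real n - 1 / (exp 1 * fact t)\<bar> \<le> \<epsilon> n}"
        by (intro measure_pmf.finite_measure_mono) (auto simp: dev_def card \<epsilon>_def \<delta>_def)
      finally show "1 - sqrt (\<kappa> n) \<le> measure_pmf.prob (nb_walk (G n) (w0 n) n)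
        {ws. \<bar>real (num_visited (G n) n t ws) / real n - 1 / (exp 1 * fact t)\<bar> \<le> \<epsilon> n}" .
    qed
  qed auto
  ultimately show ?thesis unfolding F_def by blast
qed

end
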